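(* Let $n\ge 1$, let $\lambda=(\lambda_1,\ldots,\lambda_r)\vdash s$ be a partition of a positive integer $s$, let $P_1,\ldots,P_r$ be $r$ distinct points in $\mathbb{P}^1$, and let $Q_1,\ldots,Q_{\lambda_1}$ be $\lambda_1$ distinct points in $\mathbb{P}^n$. Let $\mathbb{X}_\lambda\subseteq\mathbb{P}^1\times\mathbb{P}^n$ be the set of $s$ points $$\mathbb{X}_\lambda=\{P_i\times Q_j \mid 1\le i\le r,\ 1\le j\le\lambda_i\}.$$ Then $\mathbb{X}_\lambda$ is arithmetically Cohen-Macaulay.
   Context: $k$ is an algebraically closed field of characteristic zero, and projective spaces are over $k$. A tuple $\lambda=(\lambda_1,\ldots,\lambda_r)$ of positive integers is a partition of $s$, written $\lambda\vdash s$, if $\sum\lambda_i=s$ and $\lambda_i\ge\lambda_{i+1}$ for every $i$. The coordinate ring of $\mathbb{P}^1\times\mathbb{P}^n$ is the $\mathbb{N}^2$-graded ring $R=k[x_0,x_1,y_0,\ldots,y_n]$ with $\deg x_i=(1,0)$ and $\deg y_j=(0,1)$. For a finite set of points $\mathbb{X}\subseteq\mathbb{P}^1\times\mathbb{P}^n$, $I_{\mathbb{X}}\subseteq R$ is the ideal generated by all bihomogeneous forms vanishing at all points of $\mathbb{X}$. The set $\mathbb{X}$ is arithmetically Cohen-Macaulay (ACM) if $\dim R/I_{\mathbb{X}}=\operatorname{depth}R/I_{\mathbb{X}}=2$, i.e. $R/I_{\mathbb{X}}$ is Cohen-Macaulay (depth with respect to the ideal generated by all the variables). *)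

theory Defs
  imports
    "HOL-Algebra.Algebraic_Closure_Type"
    "HOL-Analysis.Analysis"
    "HOL-Library.Poly_Mapping"
    "HOL-Library.Extended_Nat"
begin

text \<open>Krull dimension, as the supremum of the lengths of strictly increasing chains of primes.
  The zero ring gets the value 0.\<close>

definition krull_dim :: "('a, 'b) ring_scheme \<Rightarrow> enat" where
  "krull_dim A = Sup {enat d | d.
     \<exists>p :: nat \<Rightarrow> 'a set. (\<forall>i\<le>d. primeideal (p i) A) \<and> (\<forall>i<d. p i \<subset> p (Suc i))}"

text \<open>The second conjunct says that each \<open>fs ! i\<close> is a non-zero-divisor modulo its predecessors.\<close>

definition regular_sequence :: "('a, 'b) ring_scheme \<Rightarrow> 'a list \<Rightarrow> bool" where
  "regular_sequence A fs \<longleftrightarrow>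
     set fs \<subseteq> carrier A \<and>
     (\<forall>i<length fs. \<forall>g\<in>carrier A.
        fs ! i \<otimes>\<^bsub>A\<^esub> g \<in> genideal A (set (take i fs)) \<longrightarrow> g \<in> genideal A (set (take i fs))) \<and>
     genideal A (set fs) \<noteq> carrier A"

definition depth :: "('a, 'b) ring_scheme \<Rightarrow> 'a set \<Rightarrow> enat" where
  "depth A J = Sup {enat (length fs) | fs. regular_sequence A fs \<and> set fs \<subseteq> J}"

text \<open>A point of projective space is the set of all its homogeneous coordinate vectors. The space of
  dimension \<open>n\<close> arises for \<open>CARD('i) = n + 1\<close>.\<close>

definition proportional :: "(('k::field ^ 'i::finite) \<times> ('k ^ 'i)) set" where
  "proportional = {(u, v). u \<noteq> 0 \<and> v \<noteq> 0 \<and> (\<exists>c. c \<noteq> 0 \<and> v = c *s u)}"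

definition projective_space :: "('k::field ^ 'i::finite) set set" where
  "projective_space = (UNIV - {0}) // proportional"

text \<open>The coordinate ring of $\mathbb{P}^1 \times \mathbb{P}^n$: monomials are exponent vectors and
  polynomials are finitely supported coefficient functions on monomials (multiplication is
  convolution). \<open>Inl\<close> tags the two variables $x_0, x_1$ and \<open>Inr\<close> the variables $y_0, \dots, y_n$.\<close>

type_synonym 'n monomial = "(2 + 'n) \<Rightarrow>\<^sub>0 nat"
type_synonym ('n, 'k) bipoly = "'n monomial \<Rightarrow>\<^sub>0 'k"

definition poly_var :: "2 + 'n \<Rightarrow> ('n, 'k::field) bipoly" where
  "poly_var v = Poly_Mapping.single (Poly_Mapping.single v 1) 1"

definition eval_at :: "'k ^ 2 \<Rightarrow> 'k ^ 'n \<Rightarrow> ('n::finite, 'k::field) bipoly \<Rightarrow> 'k" where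
  "eval_at a b F = (\<Sum>m\<in>Poly_Mapping.keys F. Poly_Mapping.lookup F m *
     (\<Prod>i\<in>UNIV. (a $ i) ^ Poly_Mapping.lookup m (Inl i)) *
     (\<Prod>j\<in>UNIV. (b $ j) ^ Poly_Mapping.lookup m (Inr j)))"

definition bidegree :: "'n::finite monomial \<Rightarrow> nat \<times> nat" where
  "bidegree m = ((\<Sum>i\<in>UNIV. Poly_Mapping.lookup m (Inl i)),
                (\<Sum>j\<in>UNIV. Poly_Mapping.lookup m (Inr j)))"

definition bihomogeneous :: "('n::finite, 'k::field) bipoly \<Rightarrow> bool" where
  "bihomogeneous F \<longleftrightarrow> (\<exists>d. \<forall>m\<in>Poly_Mapping.keys F. bidegree m = d)"

definition vanishes_at :: "('n::finite, 'k::field) bipoly \<Rightarrow> ('k ^ 2) set \<times> ('k ^ 'n) set \<Rightarrow> bool" where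
  "vanishes_at F PQ \<longleftrightarrow> (\<forall>a\<in>fst PQ. \<forall>b\<in>snd PQ. eval_at a b F = 0)"

abbreviation coord_ring :: "('n::finite, 'k::field) bipoly ring" where
  "coord_ring \<equiv> ring_of_type_algebra"

definition vanishing_ideal ::
    "(('k::field ^ 2) set \<times> ('k ^ 'n::finite) set) set \<Rightarrow> ('n, 'k) bipoly set" where
  "vanishing_ideal Z = genideal coord_ring {F. bihomogeneous F \<and> (\<forall>PQ\<in>Z. vanishes_at F PQ)}"

definition irrelevant_ideal :: "('n::finite, 'k::field) bipoly set" where
  "irrelevant_ideal = genideal coord_ring (range poly_var)"

text \<open>The depth of $R/I$ with respect to the ideal $\mathfrak{m}$ of $R$ generated by the variables is
  taken in the ring $R/I$ with respect to the image of $\mathfrak{m}$, since elements of $R$ act on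
  $R/I$ through their residue classes.\<close>

definition arithmetically_CM :: "(('k::field ^ 2) set \<times> ('k ^ 'n::finite) set) set \<Rightarrow> bool" where
  "arithmetically_CM Z \<longleftrightarrow>
     (let I = vanishing_ideal Z; A = coord_ring Quot I
      in krull_dim A = 2 \<and> depth A ((\<lambda>f. I +>\<^bsub>coord_ring\<^esub> f) ` irrelevant_ideal) = 2)"

definition is_partition :: "(nat \<Rightarrow> nat) \<Rightarrow> nat \<Rightarrow> nat \<Rightarrow> bool" where
  "is_partition l r s \<longleftrightarrow>
     (\<forall>i\<in>{1..r}. l i > 0) \<and> (\<Sum>i=1..r. l i) = s \<and> (\<forall>i\<in>{1..<r}. l i \<ge> l (i + 1))"

end

theory Submission
  imports Defs
begin

text \<open>Since the field is infinite, the ideal \<open>I\<close> of the configuration consists of all polynomials that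
  vanish on the affine cone over it, the union of the planes spanned by coordinate vectors of
  \<open>P\<^sub>i\<close> and \<open>Q\<^sub>j\<close> (lemma \<open>vanishing_ideal_eq\<close>). Both invariants of \<open>R/I\<close> are shown to be 2.

  Neither can exceed 2. On finitely many planes a dimension count gives a nontrivial
  polynomial relation between any three elements (\<open>algebraic_relation_on_planes\<close>). Suppose that ideals
  \<open>J\<^sub>0 \<subseteq> J\<^sub>1 \<subseteq> J\<^sub>2 \<subseteq> J\<^sub>3\<close> and elements \<open>f\<^sub>i \<in> J\<^bsub>i+1\<^esub>\<close> that are non-zero-divisors modulo \<open>J\<^sub>i\<close> were
  given. Cancelling lowest powers in a relation between the \<open>f\<^sub>i\<close> puts its lexicographically lowest coefficient into
  \<open>J\<^sub>3\<close>, which is therefore the whole ring (\<open>algebraic_relation_excludes_chain\<close>). Chains of primes of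
  length 3 and regular sequences of length 3 both produce such data with \<open>J\<^sub>3\<close> proper.

  The Krull dimension is at least 2 because a plane of the cone, a line in it and the origin have
  prime vanishing ideals. For the depth, let \<open>L\<close> be a linear form in the \<open>x\<close>-variables that vanishes at no
  \<open>P\<^sub>i\<close> and \<open>M\<close> a linear form in the \<open>y\<close>-variables that vanishes at no \<open>Q\<^sub>j\<close>. Clearly \<open>L\<close> is a
  non-zero-divisor modulo \<open>I\<close>. The shape of the partition matters for \<open>M\<close>: writing a polynomial modulo \<open>L\<close> as
  \<open>\<Sum>\<^sub>m x\<^sub>1\<^sup>m g\<^sub>m\<close> with \<open>g\<^sub>m\<close> in the \<open>y\<close>-variables, it lies in \<open>I + (L)\<close> iff \<open>g\<^sub>m\<close> vanishes at \<open>Q\<^sub>j\<close> for all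
  \<open>m < r\<close> and \<open>j \<le> \<lambda>\<^bsub>m+1\<^esub>\<close> (\<open>mem_sum_ideal_iff\<close>). Multiplication by \<open>M\<close> multiplies every \<open>g\<^sub>m\<close> by \<open>M\<close>, so \<open>M\<close>
  is a non-zero-divisor modulo \<open>I + (L)\<close>, and \<open>L, M\<close> is a regular sequence.\<close>

section \<open>Substitution into bigraded polynomials\<close>

text \<open>The coefficients are sent into an arbitrary commutative ring, so that the same lemmas cover
  evaluation at a point, restriction to a parametrised line (values in \<open>'k poly\<close>) and
  substitution of polynomials for the variables.\<close>

definition aeval :: "('k::field \<Rightarrow> 'r::comm_ring_1) \<Rightarrow> (2 + 'n::finite \<Rightarrow> 'r) \<Rightarrow> ('n, 'k) bipoly \<Rightarrow> 'r" where
  "aeval h Y F = (\<Sum>m\<in>Poly_Mapping.keys F.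
     h (Poly_Mapping.lookup F m) * (\<Prod>v\<in>UNIV. Y v ^ Poly_Mapping.lookup m v))"

locale coeff_hom =
  fixes h :: "'k::field \<Rightarrow> 'r::comm_ring_1"
  assumes h_zero: "h 0 = 0" and h_one: "h 1 = 1"
    and h_add: "h (x + y) = h x + h y" and h_mult: "h (x * y) = h x * h y"
begin

lemma aeval_superset:
  assumes "finite S" "Poly_Mapping.keys F \<subseteq> S"
  shows "aeval h Y F = (\<Sum>m\<in>S. h (Poly_Mapping.lookup F m) * (\<Prod>v\<in>UNIV. Y v ^ Poly_Mapping.lookup m v))"
  unfolding aeval_def using assms
  by (intro sum.mono_neutral_left) (auto simp: in_keys_iff h_zero)

lemma aeval_zero [simp]: "aeval h Y 0 = 0"
  by (simp add: aeval_def)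

lemma aeval_add [simp]: "aeval h Y (F + G) = aeval h Y F + aeval h Y G"
proof -
  let ?S = "Poly_Mapping.keys F \<union> Poly_Mapping.keys G"
  have "Poly_Mapping.keys (F + G) \<subseteq> ?S" by (rule keys_add)
  then show ?thesis
    by (simp add: aeval_superset[where S = ?S] lookup_add distrib_right sum.distrib h_add)
qed

lemma aeval_sum [simp]: "aeval h Y (sum f A) = (\<Sum>a\<in>A. aeval h Y (f a))"
  by (induction A rule: infinite_finite_induct) auto

lemma aeval_single [simp]:
  "aeval h Y (Poly_Mapping.single m c) = h c * (\<Prod>v\<in>UNIV. Y v ^ Poly_Mapping.lookup m v)"
  by (simp add: aeval_superset[where S = "{m}"] h_zero)

end

lemma bipoly_as_sum:
  "F = (\<Sum>m\<in>Poly_Mapping.keys F. Poly_Mapping.single m (Poly_Mapping.lookup F m))"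
  by (rule poly_mapping_eqI)
     (auto simp: lookup_sum lookup_single when_def in_keys_iff sum.delta)

context coeff_hom
begin

lemma aeval_mult [simp]: "aeval h Y (F * G) = aeval h Y F * aeval h Y G"
proof -
  let ?s = "\<lambda>F m. Poly_Mapping.single m (Poly_Mapping.lookup F m)"
  have *: "aeval h Y (Poly_Mapping.single m c * Poly_Mapping.single m' c') =
      aeval h Y (Poly_Mapping.single m c) * aeval h Y (Poly_Mapping.single m' c')" for m m' c c'
    by (simp add: mult_single lookup_add power_add prod.distrib h_mult)
  have "F * G = (\<Sum>m\<in>Poly_Mapping.keys F. ?s F m) * (\<Sum>m\<in>Poly_Mapping.keys G. ?s G m)"
    by (simp only: bipoly_as_sum[symmetric])
  also have "aeval h Y \<dots> =
      aeval h Y (\<Sum>m\<in>Poly_Mapping.keys F. ?s F m) * aeval h Y (\<Sum>m\<in>Poly_Mapping.keys G. ?s G m)"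
    by (simp only: sum_product aeval_sum *)
  finally show ?thesis
    by (simp only: bipoly_as_sum[symmetric])
qed

lemma aeval_one [simp]: "aeval h Y 1 = 1"
  by (subst single_one[symmetric]) (simp del: single_one add: h_one)

lemma aeval_uminus [simp]: "aeval h Y (- F) = - aeval h Y F"
proof -
  have "aeval h Y F + aeval h Y (- F) = 0"
    by (subst aeval_add[symmetric]) simp
  then show ?thesis by (simp add: add_eq_0_iff)
qed

lemma aeval_diff [simp]: "aeval h Y (F - G) = aeval h Y F - aeval h Y G"
  using aeval_add[of Y F "- G"] by (simp del: aeval_add)

lemma aeval_power [simp]: "aeval h Y (F ^ k) = aeval h Y F ^ k"
  by (induction k) auto

lemma aeval_prod [simp]: "aeval h Y (prod f A) = (\<Prod>a\<in>A. aeval h Y (f a))"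
  by (induction A rule: infinite_finite_induct) auto

lemma aeval_poly_var [simp]: "aeval h Y (poly_var v) = Y v"
proof -
  have "(\<Prod>w\<in>UNIV. Y w ^ Poly_Mapping.lookup (Poly_Mapping.single v 1) w) =
     (\<Prod>w\<in>UNIV. if w = v then Y w else 1)"
    by (rule prod.cong) (auto simp: lookup_single when_def)
  then show ?thesis by (simp add: poly_var_def h_one)
qed

end

abbreviation const :: "'k::field \<Rightarrow> ('n::finite, 'k) bipoly" where
  "const \<equiv> Poly_Mapping.single 0"

interpretation ev: coeff_hom "\<lambda>c::'k::field. c"
  by unfold_locales auto

interpretation up: coeff_hom "\<lambda>c::'k::field. [:c:]"
  by unfold_locales auto

abbreviation ev :: "(2 + 'n::finite \<Rightarrow> 'k::field) \<Rightarrow> ('n, 'k) bipoly \<Rightarrow> 'k" where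
  "ev \<equiv> aeval (\<lambda>c. c)"

abbreviation up :: "(2 + 'n::finite \<Rightarrow> 'k::field poly) \<Rightarrow> ('n, 'k) bipoly \<Rightarrow> 'k poly" where
  "up \<equiv> aeval (\<lambda>c. [:c:])"

lemma poly_up [simp]: "poly (up Y F) t = ev (\<lambda>v. poly (Y v) t) F"
  by (simp add: aeval_def poly_sum poly_prod)

lemma ev_aeval_const [simp]: "ev x (aeval const Y F) = ev (\<lambda>v. ev x (Y v)) F"
  by (simp add: aeval_def[of const] aeval_def[of _ "\<lambda>v. ev x (Y v)"])

lemma aeval_const_poly_var: "aeval const poly_var F = F"
proof -
  have mono: "(\<Prod>v\<in>UNIV. poly_var v ^ Poly_Mapping.lookup m v) =
      (Poly_Mapping.single m 1 :: ('a, 'b) bipoly)" for m :: "'a monomial"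
  proof -
    have pow: "poly_var v ^ k = (Poly_Mapping.single (Poly_Mapping.single v k) 1 :: ('a, 'b) bipoly)" for v k
      by (induction k) (auto simp: poly_var_def mult_single single_add[symmetric])
    have "(\<Prod>v\<in>S. poly_var v ^ Poly_Mapping.lookup m v) =
       (Poly_Mapping.single (\<Sum>v\<in>S. Poly_Mapping.single v (Poly_Mapping.lookup m v)) 1 :: ('a, 'b) bipoly)"
      if "finite S" for S
      using that by (induction S) (auto simp: pow mult_single)
    moreover have "(\<Sum>v\<in>UNIV. Poly_Mapping.single v (Poly_Mapping.lookup m v)) = m"
      by (rule poly_mapping_eqI) (simp add: lookup_sum lookup_single when_def sum.delta)
    ultimately show ?thesis by simp
  qed
  show ?thesis
    unfolding aeval_def mono by (simp add: mult_single bipoly_as_sum[symmetric])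
qed

lemma degree_up_le:
  assumes "\<And>m. m \<in> Poly_Mapping.keys F \<Longrightarrow> (\<Sum>v\<in>UNIV. Poly_Mapping.lookup m v * Polynomial.degree (Y v)) \<le> d"
  shows "Polynomial.degree (up Y F) \<le> d"
  unfolding aeval_def
proof (rule degree_sum_le)
  fix m assume m: "m \<in> Poly_Mapping.keys F"
  have "Polynomial.degree (\<Prod>v\<in>UNIV. Y v ^ Poly_Mapping.lookup m v) \<le>
      (\<Sum>v\<in>UNIV. Polynomial.degree (Y v ^ Poly_Mapping.lookup m v))"
    using degree_prod_sum_le[of UNIV "\<lambda>v. Y v ^ Poly_Mapping.lookup m v"] by (simp add: o_def)
  also have "\<dots> \<le> (\<Sum>v\<in>UNIV. Poly_Mapping.lookup m v * Polynomial.degree (Y v))"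
    by (intro sum_mono) (simp add: degree_power_le mult.commute[of "Poly_Mapping.lookup m _"])
  also have "\<dots> \<le> d" using assms m by blast
  finally show "Polynomial.degree ([:Poly_Mapping.lookup F m:] * (\<Prod>v\<in>UNIV. Y v ^ Poly_Mapping.lookup m v)) \<le> d"
    by (intro order.trans[OF degree_mult_le]) simp
qed simp

definition point :: "'k ^ 2 \<Rightarrow> 'k ^ 'n \<Rightarrow> 2 + 'n \<Rightarrow> 'k" where
  "point a b = case_sum (($) a) (($) b)"

lemma point_simps [simp]: "point a b (Inl i) = a $ i" "point a b (Inr j) = b $ j"
  by (simp_all add: point_def)

lemma prod_UNIV_sum:
  "(\<Prod>v\<in>(UNIV :: ('a::finite + 'b::finite) set). f v) = (\<Prod>i\<in>UNIV. f (Inl i)) * (\<Prod>j\<in>UNIV. f (Inr j))"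
  by (simp add: UNIV_Plus_UNIV[symmetric] prod.Plus del: UNIV_Plus_UNIV)

lemma eval_at_eq_ev: "eval_at a b F = ev (point a b) F"
  by (simp add: eval_at_def aeval_def prod_UNIV_sum mult.assoc)

text \<open>The form in which the infinitude of the field enters: finitely many parameters of a curve may
  be exempted from a vanishing condition.\<close>

lemma poly_eq_0_if_cofinite:
  fixes p :: "'k::field_char_0 poly"
  assumes "finite E" "\<And>t. t \<notin> E \<Longrightarrow> poly p t = 0"
  shows "p = 0"
proof (rule ccontr)
  assume "p \<noteq> 0"
  then have "finite {t. poly p t = 0}" by (rule poly_roots_finite)
  then have "finite (E \<union> {t. poly p t = 0})" using assms(1) by blast
  moreover have "E \<union> {t. poly p t = 0} = UNIV" using assms(2) by blast
  ultimately show False using infinite_UNIV_char_0 by metis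
qed

section \<open>Algebraic relations and chains of ideals\<close>

text \<open>A homogeneous linear system with more unknowns than equations: one unknown is eliminated
  together with one equation.\<close>

lemma nontrivial_solution:
  fixes f :: "'s \<Rightarrow> 't \<Rightarrow> 'k::field"
  assumes "finite T" "finite S" "card T < card S"
  shows "\<exists>c. (\<exists>s\<in>S. c s \<noteq> 0) \<and> (\<forall>t\<in>T. (\<Sum>s\<in>S. c s * f s t) = 0)"
  using assms
proof (induction T arbitrary: S f rule: finite_induct)
  case empty
  then have "S \<noteq> {}" by auto
  then show ?case by (intro exI[of _ "\<lambda>_. 1"]) auto
next
  case (insert t0 T)
  show ?case
  proof (cases "\<forall>s\<in>S. f s t0 = 0")
    case True
    have "card T < card S" using insert by simp
    from insert.IH[OF insert.prems(1) this, of f] True show ?thesis by auto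
  next
    case False
    then obtain s0 where s0: "s0 \<in> S" "f s0 t0 \<noteq> 0" by blast
    define q where "q s = f s t0 / f s0 t0" for s
    have "card T < card (S - {s0})" using insert s0 by simp
    from insert.IH[OF _ this, of "\<lambda>s t. f s t - q s * f s0 t"] insert.prems(1)
    obtain c where c: "\<exists>s\<in>S - {s0}. c s \<noteq> 0"
      "\<And>t. t \<in> T \<Longrightarrow> (\<Sum>s\<in>S - {s0}. c s * (f s t - q s * f s0 t)) = 0" by auto
    define c' where "c' = c(s0 := - (\<Sum>s\<in>S - {s0}. c s * q s))"
    have eq: "(\<Sum>s\<in>S. c' s * f s t) = (\<Sum>s\<in>S - {s0}. c s * (f s t - q s * f s0 t))" for t
    proof -
      have "(\<Sum>s\<in>S. c' s * f s t) = c' s0 * f s0 t + (\<Sum>s\<in>S - {s0}. c' s * f s t)"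
        using insert.prems(1) s0(1) by (rule sum.remove)
      also have "(\<Sum>s\<in>S - {s0}. c' s * f s t) = (\<Sum>s\<in>S - {s0}. c s * f s t)"
        by (rule sum.cong) (auto simp: c'_def)
      finally show ?thesis
        by (simp add: c'_def right_diff_distrib sum_subtractf sum_distrib_right mult.assoc)
    qed
    have "(\<Sum>s\<in>S. c' s * f s t) = 0" if "t \<in> insert t0 T" for t
    proof (cases "t = t0")
      case True
      then show ?thesis unfolding eq using s0 by (simp add: q_def)
    next
      case False
      then show ?thesis using c(2) that eq by simp
    qed
    moreover have "\<exists>s\<in>S. c' s \<noteq> 0" using c(1) by (auto simp: c'_def)
    ultimately show ?thesis by blast
  qed
qed

abbreviation type_ring :: "'r::comm_ring_1 ring" where
  "type_ring \<equiv> ring_of_type_algebra"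

lemma type_ring_simps [simp]:
  "carrier type_ring = UNIV" "ring.add type_ring = (+)" "monoid.mult type_ring = (*)"
  "ring.zero type_ring = 0" "monoid.one type_ring = 1"
  by (auto simp: ring_of_type_algebra_def fun_eq_iff)

lemma ideal_type_ring_iff:
  fixes J :: "'r::comm_ring_1 set"
  shows "ideal J type_ring \<longleftrightarrow>
    0 \<in> J \<and> (\<forall>x\<in>J. \<forall>y\<in>J. x + y \<in> J) \<and> (\<forall>x\<in>J. \<forall>y. y * x \<in> J)"
proof
  assume "ideal J type_ring"
  then interpret ideal J type_ring .
  show "0 \<in> J \<and> (\<forall>x\<in>J. \<forall>y\<in>J. x + y \<in> J) \<and> (\<forall>x\<in>J. \<forall>y. y * x \<in> J)"
    using additive_subgroup.zero_closed[OF is_additive_subgroup]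
      additive_subgroup.a_closed[OF is_additive_subgroup] I_l_closed by simp
next
  assume *: "0 \<in> J \<and> (\<forall>x\<in>J. \<forall>y\<in>J. x + y \<in> J) \<and> (\<forall>x\<in>J. \<forall>y. y * x \<in> J)"
  interpret cring "type_ring :: 'r ring" by (rule cring_from_type_algebra)
  have neg: "- x \<in> J" if "x \<in> J" for x
    using * that by (metis mult_minus1)
  have sub: "subgroup J (add_monoid type_ring)"
  proof (rule add.subgroupI)
    fix a assume "a \<in> J"
    moreover have "\<ominus>\<^bsub>type_ring\<^esub> a = - a"
      by (rule minus_equality) auto
    ultimately show "\<ominus>\<^bsub>type_ring\<^esub> a \<in> J"
      using neg by simp
  next
    show "J \<noteq> {}" using * by blast
  qed (use * in simp_all)
  show "ideal J type_ring"
    by (rule idealI[OF ring_axioms sub]) (use * in \<open>simp_all add: mult.commute[of _ "_ :: 'r"]\<close>)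
qed

lemma
  fixes J :: "'r::comm_ring_1 set"
  assumes "ideal J type_ring"
  shows ideal_zero: "0 \<in> J"
    and ideal_add: "x \<in> J \<Longrightarrow> y \<in> J \<Longrightarrow> x + y \<in> J"
    and ideal_mult_left: "x \<in> J \<Longrightarrow> y * x \<in> J"
    and ideal_mult_right: "x \<in> J \<Longrightarrow> x * y \<in> J"
    and ideal_diff: "x \<in> J \<Longrightarrow> y \<in> J \<Longrightarrow> x - y \<in> J"
    and ideal_sum: "(\<And>a. a \<in> A \<Longrightarrow> f a \<in> J) \<Longrightarrow> sum f A \<in> J"
proof -
  note * = assms[unfolded ideal_type_ring_iff]
  show zero: "0 \<in> J" and add: "x \<in> J \<Longrightarrow> y \<in> J \<Longrightarrow> x + y \<in> J"
    and mult: "x \<in> J \<Longrightarrow> y * x \<in> J" for x y using * by auto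
  show "x \<in> J \<Longrightarrow> x * y \<in> J" using mult[of x y] by (simp add: mult.commute)
  show "x \<in> J \<Longrightarrow> y \<in> J \<Longrightarrow> x - y \<in> J" using add[of x "- y"] mult[of y "-1"] by simp
  show "(\<And>a. a \<in> A \<Longrightarrow> f a \<in> J) \<Longrightarrow> sum f A \<in> J"
    by (induction A rule: infinite_finite_induct) (auto intro: zero add)
qed

lemma ideal_prod_cong:
  fixes f g :: "'a \<Rightarrow> 'r::comm_ring_1"
  assumes J: "ideal J type_ring" and "\<And>a. a \<in> A \<Longrightarrow> f a - g a \<in> J"
  shows "prod f A - prod g A \<in> J"
  using assms(2)
proof (induction A rule: infinite_finite_induct)
  case (insert a A)
  have "prod f (insert a A) - prod g (insert a A) = (f a - g a) * prod f A + g a * (prod f A - prod g A)"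
    using insert.hyps by (simp add: algebra_simps)
  also have "\<dots> \<in> J"
    using insert by (intro ideal_add[OF J] ideal_mult_left[OF J] ideal_mult_right[OF J]) auto
  finally show ?case .
qed (simp_all add: ideal_zero[OF J])

lemma ideal_aeval_cong:
  assumes J: "ideal J type_ring" and "\<And>v. X' v - Y v \<in> J"
  shows "aeval h X' F - aeval h Y F \<in> J"
proof -
  have "X' v ^ k - Y v ^ k \<in> J" for v k
    using ideal_prod_cong[OF J, of "{..<k}" "\<lambda>_. X' v" "\<lambda>_. Y v"] assms(2) by simp
  then have "(\<Prod>v\<in>UNIV. X' v ^ Poly_Mapping.lookup m v) - (\<Prod>v\<in>UNIV. Y v ^ Poly_Mapping.lookup m v) \<in> J" for m
    by (intro ideal_prod_cong[OF J])
  then show ?thesis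
    unfolding aeval_def sum_subtractf[symmetric] right_diff_distrib[symmetric]
    by (intro ideal_sum[OF J] ideal_mult_left[OF J])
qed

text \<open>Modulo \<open>J\<close> the lowest power of \<open>F\<close> cancels, since \<open>F\<close> is a non-zero-divisor there, and modulo the
  larger ideal \<open>J'\<close>, which contains \<open>F\<close>, only the lowest coefficient survives.\<close>

lemma lowest_coefficient_mem:
  fixes F :: "'r::comm_ring_1"
  assumes J: "ideal J type_ring" "ideal J' type_ring" "J \<subseteq> J'" "F \<in> J'"
    and reg: "\<And>g. F * g \<in> J \<Longrightarrow> g \<in> J"
    and sum: "(\<Sum>a<N. F ^ a * g a) \<in> J" and low: "\<And>a. a < m \<Longrightarrow> g a = 0" and m: "m < N"
  shows "g m \<in> J'"
proof -
  define h where "h = (\<Sum>a\<in>{Suc m..<N}. F ^ (a - Suc m) * g a)"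
  have "(\<Sum>a<N. F ^ a * g a) = (\<Sum>a\<in>{m..<N}. F ^ a * g a)"
    using low by (intro sum.mono_neutral_right) auto
  also have "\<dots> = F ^ m * g m + (\<Sum>a\<in>{Suc m..<N}. F ^ a * g a)"
    using m by (simp add: sum.atLeast_Suc_lessThan)
  also have "(\<Sum>a\<in>{Suc m..<N}. F ^ a * g a) = F ^ m * (F * h)"
    unfolding h_def sum_distrib_left
  proof (rule sum.cong)
    fix a assume "a \<in> {Suc m..<N}"
    then have "F ^ a = F ^ (m + Suc (a - Suc m))" by simp
    then show "F ^ a * g a = F ^ m * (F * (F ^ (a - Suc m) * g a))"
      by (simp only: power_add power_Suc mult.assoc)
  qed simp
  finally have "F ^ m * (g m + F * h) \<in> J"
    using sum by (simp add: distrib_left)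
  moreover have "x \<in> J" if "F ^ i * x \<in> J" for i x
    using that by (induction i) (auto simp: mult.assoc dest: reg)
  ultimately have "g m + F * h \<in> J'" using J by blast
  moreover have "F * h \<in> J'" using J ideal_mult_right by blast
  ultimately have "(g m + F * h) - F * h \<in> J'" using J ideal_diff by blast
  then show ?thesis by simp
qed

text \<open>Cancelling the lowest powers of \<open>F 0\<close>, \<open>F 1\<close> and \<open>F 2\<close> in turn leaves the lexicographically lowest
  coefficient of the relation, a unit, in the last ideal. The hypotheses on the chain are shared by
  a chain of four primes with \<open>F i\<close> chosen in the gaps and by the ideals generated by the
  initial segments of a regular sequence of length three; this is how one argument bounds both
  Krull dimension and depth.\<close>

lemma algebraic_relation_excludes_chain:
  fixes C :: "'k::field \<Rightarrow> 'r::comm_ring_1" and J :: "nat \<Rightarrow> 'r set"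
  assumes C: "C 0 = 0" "C 1 = 1" "\<And>x y. C (x * y) = C x * C y"
    and ideal: "\<And>i. i \<le> 3 \<Longrightarrow> ideal (J i) type_ring"
    and chain: "\<And>i. i < 3 \<Longrightarrow> J i \<subseteq> J (Suc i)"
    and mem: "\<And>i. i < 3 \<Longrightarrow> F i \<in> J (Suc i)"
    and reg: "\<And>i g. i < 3 \<Longrightarrow> F i * g \<in> J i \<Longrightarrow> g \<in> J i"
    and nz: "\<exists>x<N. \<exists>y<N. \<exists>z<N. c x y z \<noteq> 0"
    and rel: "(\<Sum>x<N. \<Sum>y<N. \<Sum>z<N. C (c x y z) * (F 0 ^ x * F 1 ^ y * F 2 ^ z)) \<in> J 0"
  shows "J 3 = UNIV"
proof -
  define g2 where "g2 x y z = C (c x y z)" for x y z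
  define g1 where "g1 x y = (\<Sum>z<N. F 2 ^ z * g2 x y z)" for x y
  define g0 where "g0 x = (\<Sum>y<N. F 1 ^ y * g1 x y)" for x
  have eq: "(\<Sum>x<N. \<Sum>y<N. \<Sum>z<N. C (c x y z) * (F 0 ^ x * F 1 ^ y * F 2 ^ z)) = (\<Sum>x<N. F 0 ^ x * g0 x)"
    unfolding g0_def g1_def g2_def by (simp add: sum_distrib_left mult_ac)
  have step: "g m \<in> J (Suc i)" if "i < 3" "(\<Sum>a<N. F i ^ a * g a) \<in> J i" "\<And>a. a < m \<Longrightarrow> g a = 0" "m < N" for i g m
  proof (rule lowest_coefficient_mem[where J = "J i" and F = "F i" and N = N])
    show "ideal (J i) type_ring" "ideal (J (Suc i)) type_ring" using that(1) by (auto intro: ideal)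
  qed (fact that chain[OF that(1)] mem[OF that(1)] reg[OF that(1)])+
  have least: "\<exists>x<N. P x \<and> (\<forall>a<x. \<not> P a)" if "\<exists>x<N. P x" for P
    using that by (metis exists_least_iff less_trans not_less_iff_gr_or_eq)
  define P0 where "P0 x \<longleftrightarrow> (\<exists>y<N. \<exists>z<N. c x y z \<noteq> 0)" for x
  obtain x where x: "x < N" "P0 x" "\<And>a. a < x \<Longrightarrow> \<not> P0 a"
    using least[of P0] nz by (auto simp: P0_def)
  define P1 where "P1 y \<longleftrightarrow> (\<exists>z<N. c x y z \<noteq> 0)" for y
  obtain y where y: "y < N" "P1 y" "\<And>a. a < y \<Longrightarrow> \<not> P1 a"
    using least[of P1] x(2) by (auto simp: P0_def P1_def)
  define P2 where "P2 z \<longleftrightarrow> c x y z \<noteq> 0" for z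
  obtain z where z: "z < N" "P2 z" "\<And>a. a < z \<Longrightarrow> \<not> P2 a"
    using least[of P2] y(2) by (auto simp: P1_def P2_def)
  have "g0 x \<in> J (Suc 0)"
    using rel x eq by (intro step[of 0 g0]) (auto simp: g0_def g1_def g2_def P0_def C)
  then have "g1 x y \<in> J (Suc 1)"
    using y by (intro step[of 1 "g1 x"]) (auto simp: g0_def g1_def g2_def P1_def C)
  then have "g2 x y z \<in> J (Suc 2)"
    using z by (intro step[of 2 "g2 x y"]) (auto simp: g1_def g2_def P2_def C numeral_2_eq_2)
  then have "C (c x y z) \<in> J 3" by (simp add: g2_def)
  then have "C (inverse (c x y z)) * C (c x y z) \<in> J 3"
    by (rule ideal_mult_left[OF ideal[OF order.refl]])
  moreover have "C (inverse (c x y z)) * C (c x y z) = 1"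
    using z(2) by (simp add: P2_def C(2) flip: C(3))
  ultimately have "1 \<in> J 3" by simp
  then have "w \<in> J 3" for w using ideal_mult_left[of "J 3" 1 w] ideal by simp
  then show ?thesis by blast
qed

section \<open>Dimension and depth of quotient rings\<close>

abbreviation coset :: "'r::comm_ring_1 set \<Rightarrow> 'r \<Rightarrow> 'r set" where
  "coset I F \<equiv> I +>\<^bsub>type_ring\<^esub> F"

lemma carrier_quotient: "carrier (type_ring Quot I) = range (coset I)"
  by (auto simp: FactRing_def A_RCOSETS_def')

context
  fixes I :: "'r::comm_ring_1 set"
  assumes I: "ideal I type_ring"
begin

interpretation R: cring "type_ring :: 'r ring" by (rule cring_from_type_algebra)

interpretation ideal I type_ring by (rule I)

interpretation A: cring "type_ring Quot I" by (rule quotient_is_cring[OF R.is_cring])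

lemma coset_eq_iff: "coset I F = coset I G \<longleftrightarrow> F - G \<in> I"
proof -
  have "\<ominus>\<^bsub>type_ring\<^esub> G = - G" by (rule R.minus_equality) auto
  then show ?thesis
    using R.quotient_eq_iff_same_a_r_cos[OF I, of F G] by (simp add: a_minus_def)
qed

lemma coset_mult: "coset I F \<otimes>\<^bsub>type_ring Quot I\<^esub> coset I G = coset I (F * G)"
  using rcoset_mult_add[of F G] by (simp add: FactRing_def)

lemma coset_mem_image_iff:
  assumes "ideal K type_ring" "I \<subseteq> K"
  shows "coset I F \<in> coset I ` K \<longleftrightarrow> F \<in> K"
proof
  assume "coset I F \<in> coset I ` K"
  then obtain G where "G \<in> K" "F - G \<in> I" by (auto simp: coset_eq_iff)
  then show "F \<in> K" using ideal_add[OF assms(1), of "F - G" G] assms(2) by auto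
qed auto

lemma ideal_coset_preimage:
  assumes "ideal J (type_ring Quot I)"
  shows "ideal {F. coset I F \<in> J} type_ring"
  using ring_hom_ring.ideal_vimage[OF rcos_ring_hom_ring assms] by simp

lemma primeideal_coset_image:
  assumes "primeideal K type_ring" "I \<subseteq> K"
  shows "primeideal (coset I ` K) (type_ring Quot I)"
proof -
  interpret K: primeideal K type_ring by (rule assms)
  note mem = coset_mem_image_iff[OF K.is_ideal assms(2)]
  show ?thesis
  proof (intro primeidealI R.ring_ideal_imp_quot_ideal I K.is_ideal A.is_cring)
    obtain F where "F \<notin> K" using K.I_notcarr by auto
    then show "carrier (type_ring Quot I) \<noteq> coset I ` K"
      using mem[of F] by (auto simp: carrier_quotient)
  next
    fix a b
    assume "a \<in> carrier (type_ring Quot I)" "b \<in> carrier (type_ring Quot I)"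
      and ab: "a \<otimes>\<^bsub>type_ring Quot I\<^esub> b \<in> coset I ` K"
    then obtain F G where "a = coset I F" "b = coset I G" by (auto simp: carrier_quotient)
    then show "a \<in> coset I ` K \<or> b \<in> coset I ` K"
      using ab K.I_prime[of F G] by (simp add: coset_mult mem)
  qed
qed

text \<open>Generated ideals of the quotient are computed upstairs: the last two assumptions say that \<open>K\<close>
  is the ideal generated by \<open>I\<close> and \<open>S\<close>.\<close>

lemma genideal_coset:
  "genideal (type_ring Quot I) (coset I ` S) = coset I ` K"
  if "ideal K type_ring" "I \<subseteq> K" "S \<subseteq> K" "\<And>J. ideal J type_ring \<Longrightarrow> I \<subseteq> J \<Longrightarrow> S \<subseteq> J \<Longrightarrow> K \<subseteq> J"
proof
  show "genideal (type_ring Quot I) (coset I ` S) \<subseteq> coset I ` K"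
    by (rule A.genideal_minimal[OF R.ring_ideal_imp_quot_ideal[OF I that(1)]]) (use that in blast)
  have S: "coset I ` S \<subseteq> carrier (type_ring Quot I)" by (auto simp: carrier_quotient)
  define J where "J = {F. coset I F \<in> genideal (type_ring Quot I) (coset I ` S)}"
  have gen: "ideal (genideal (type_ring Quot I) (coset I ` S)) (type_ring Quot I)"
    by (rule A.genideal_ideal[OF S])
  have J: "ideal J type_ring" unfolding J_def by (rule ideal_coset_preimage[OF gen])
  have "S \<subseteq> J" using A.genideal_self[OF S] by (auto simp: J_def)
  moreover have "I \<subseteq> J"
  proof
    fix F assume "F \<in> I"
    then have "coset I F = coset I 0" by (simp add: coset_eq_iff)
    moreover have "0 \<in> J" by (rule ideal_zero[OF J])
    ultimately show "F \<in> J" by (simp add: J_def)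
  qed
  ultimately have "K \<subseteq> J" using that J by blast
  then show "coset I ` K \<subseteq> genideal (type_ring Quot I) (coset I ` S)"
    by (auto simp: J_def)
qed

context
  fixes C :: "'k::field \<Rightarrow> 'r"
  assumes C: "C 0 = 0" "C 1 = 1" "\<And>x y. C (x * y) = C x * C y"
    and rel: "\<And>F :: nat \<Rightarrow> 'r. \<exists>N c. (\<exists>x<N. \<exists>y<N. \<exists>z<N. c x y z \<noteq> 0) \<and>
      (\<Sum>x<N. \<Sum>y<N. \<Sum>z<N. C (c x y z) * (F 0 ^ x * F 1 ^ y * F 2 ^ z)) \<in> I"
begin

lemma quotient_chain_exhausts:
  fixes J :: "nat \<Rightarrow> 'r set set"
  assumes ideal: "\<And>i. i \<le> 3 \<Longrightarrow> ideal (J i) (type_ring Quot I)"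
    and chain: "\<And>i. i < 3 \<Longrightarrow> J i \<subseteq> J (Suc i)"
    and mem: "\<And>i. i < 3 \<Longrightarrow> f i \<in> J (Suc i)"
    and reg: "\<And>i g. i < 3 \<Longrightarrow> g \<in> carrier (type_ring Quot I) \<Longrightarrow>
      f i \<otimes>\<^bsub>type_ring Quot I\<^esub> g \<in> J i \<Longrightarrow> g \<in> J i"
  shows "J 3 = carrier (type_ring Quot I)"
proof -
  have "\<exists>G. i < 3 \<longrightarrow> f i = coset I G" for i
    using mem[of i] additive_subgroup.a_subset[OF ideal.axioms(1)[OF ideal[of "Suc i"]]]
    by (cases "i < 3") (auto simp: carrier_quotient)
  then obtain F where F: "i < 3 \<Longrightarrow> f i = coset I (F i)" for i by metis
  define K where "K i = {G. coset I G \<in> J i}" for i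
  have idK: "ideal (K i) type_ring" if "i \<le> 3" for i
    unfolding K_def by (rule ideal_coset_preimage[OF ideal[OF that]])
  have IK: "I \<subseteq> K 0"
  proof
    fix G assume "G \<in> I"
    then have "coset I G = coset I 0" by (simp add: coset_eq_iff)
    moreover have "0 \<in> K 0" by (rule ideal_zero[OF idK]) simp
    ultimately show "G \<in> K 0" by (simp add: K_def)
  qed
  obtain N c where nz: "\<exists>x<N. \<exists>y<N. \<exists>z<N. c x y z \<noteq> 0"
    and r: "(\<Sum>x<N. \<Sum>y<N. \<Sum>z<N. C (c x y z) * (F 0 ^ x * F 1 ^ y * F 2 ^ z)) \<in> I"
    using rel[of F] by blast
  have "K 3 = UNIV"
  proof (rule algebraic_relation_excludes_chain[OF C idK _ _ _ nz])
    show "K i \<subseteq> K (Suc i)" "F i \<in> K (Suc i)" if "i < 3" for i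
      using chain[OF that] mem[OF that] F[OF that] by (auto simp: K_def)
    show "g \<in> K i" if "i < 3" "F i * g \<in> K i" for i g
      using reg[OF that(1), of "coset I g"] that F[OF that(1)]
      by (simp add: K_def coset_mult carrier_quotient)
    show "(\<Sum>x<N. \<Sum>y<N. \<Sum>z<N. C (c x y z) * (F 0 ^ x * F 1 ^ y * F 2 ^ z)) \<in> K 0"
      using IK r by blast
  qed
  then show ?thesis
    using additive_subgroup.a_subset[OF ideal.axioms(1)[OF ideal[of 3]]]
    by (auto simp: K_def carrier_quotient)
qed

text \<open>In a chain of primes, an element of a gap is a non-zero-divisor modulo the smaller prime.\<close>

lemma krull_dim_quotient_le: "krull_dim (type_ring Quot I) \<le> 2"
  unfolding krull_dim_def
proof (rule Sup_least, clarify)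
  fix d and p :: "nat \<Rightarrow> 'r set set"
  assume prime: "\<forall>i\<le>d. primeideal (p i) (type_ring Quot I)" and sub: "\<forall>i<d. p i \<subset> p (Suc i)"
  have "d \<le> 2"
  proof (rule ccontr)
    assume "\<not> d \<le> 2"
    then have d: "3 \<le> d" by simp
    have "\<exists>g. i < 3 \<longrightarrow> g \<in> p (Suc i) \<and> g \<notin> p i" for i
    proof (cases "i < 3")
      case True
      then have "p i \<subset> p (Suc i)" using sub d by auto
      then show ?thesis by auto
    qed simp
    then obtain f where f: "i < 3 \<Longrightarrow> f i \<in> p (Suc i) \<and> f i \<notin> p i" for i by metis
    have pr: "primeideal (p i) (type_ring Quot I)" if "i \<le> 3" for i
      using prime d that by auto
    have id: "ideal (p i) (type_ring Quot I)" if "i \<le> 3" for i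
      using pr[OF that] by (rule primeideal.axioms(1))
    have "p 3 = carrier (type_ring Quot I)"
    proof (rule quotient_chain_exhausts[of p f, OF id])
      fix i :: nat assume i: "i < 3"
      have "i < d" using d i by simp
      then show "p i \<subseteq> p (Suc i)" using sub by blast
      show "f i \<in> p (Suc i)" using f i by blast
      fix g assume g: "g \<in> carrier (type_ring Quot I)" "f i \<otimes>\<^bsub>type_ring Quot I\<^esub> g \<in> p i"
      have "f i \<in> carrier (type_ring Quot I)"
        using f[OF i] additive_subgroup.a_subset[OF ideal.axioms(1)[OF id[of "Suc i"]]] i by auto
      then show "g \<in> p i" using primeideal.I_prime[OF pr[of i]] g f[OF i] i by auto
    qed
    then show False using primeideal.I_notcarr[OF pr[of 3]] by simp
  qed
  then show "enat d \<le> 2" by (simp add: numeral_eq_enat)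
qed

lemma depth_quotient_le: "depth (type_ring Quot I) M \<le> 2"
  unfolding depth_def
proof (rule Sup_least, clarify)
  fix fs :: "'r set list"
  assume fs: "regular_sequence (type_ring Quot I) fs"
  have carr: "set fs \<subseteq> carrier (type_ring Quot I)"
    and reg: "\<And>i g. i < length fs \<Longrightarrow> g \<in> carrier (type_ring Quot I) \<Longrightarrow>
        fs ! i \<otimes>\<^bsub>type_ring Quot I\<^esub> g \<in> genideal (type_ring Quot I) (set (take i fs)) \<Longrightarrow>
        g \<in> genideal (type_ring Quot I) (set (take i fs))"
    and proper: "genideal (type_ring Quot I) (set fs) \<noteq> carrier (type_ring Quot I)"
    using fs unfolding regular_sequence_def by auto
  have "length fs \<le> 2"
  proof (rule ccontr)
    assume "\<not> length fs \<le> 2"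
    then have len: "3 \<le> length fs" by simp
    define J where "J i = genideal (type_ring Quot I) (set (take i fs))" for i
    have tk: "set (take i fs) \<subseteq> carrier (type_ring Quot I)" for i
      using carr by (meson set_take_subset subset_trans)
    have id: "ideal (J i) (type_ring Quot I)" for i
      unfolding J_def by (rule A.genideal_ideal[OF tk])
    have "J 3 = carrier (type_ring Quot I)"
    proof (rule quotient_chain_exhausts[of J "\<lambda>i. fs ! i", OF id])
      fix i :: nat assume i: "i < 3"
      show "J i \<subseteq> J (Suc i)"
        unfolding J_def by (rule A.subset_Idl_subset[OF tk]) (simp add: set_take_subset_set_take)
      have "fs ! i \<in> set (take (Suc i) fs)" using i len by (simp add: take_Suc_conv_app_nth)
      then show "fs ! i \<in> J (Suc i)" using A.genideal_self[OF tk[of "Suc i"]] by (auto simp: J_def)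
      show "g \<in> J i" if "g \<in> carrier (type_ring Quot I)" "fs ! i \<otimes>\<^bsub>type_ring Quot I\<^esub> g \<in> J i" for g
        using reg[of i g] that i len by (simp add: J_def)
    qed
    moreover have "J 3 \<subseteq> genideal (type_ring Quot I) (set fs)"
      unfolding J_def by (rule A.subset_Idl_subset[OF carr set_take_subset])
    ultimately show False
      using proper additive_subgroup.a_subset[OF ideal.axioms(1)[OF A.genideal_ideal[OF carr]]] by blast
  qed
  then show "enat (length fs) \<le> 2" by (simp add: numeral_eq_enat)
qed

end

lemma two_le_krull_dim_quotient:
  assumes "primeideal K0 type_ring" "primeideal K1 type_ring" "primeideal K2 type_ring"
    and "I \<subseteq> K0" "K0 \<subset> K1" "K1 \<subset> K2"
  shows "2 \<le> krull_dim (type_ring Quot I)"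
proof -
  define K where "K i = (if i = 0 then K0 else if i = Suc 0 then K1 else K2)" for i
  have pr: "primeideal (K i) type_ring" and sub: "I \<subseteq> K i" for i
    using assms by (auto simp: K_def)
  have strict: "coset I ` K i \<subset> coset I ` K (Suc i)" if "i < 2" for i
  proof -
    have "K i \<subset> K (Suc i)" using that assms by (auto simp: K_def)
    then obtain F where "F \<in> K (Suc i)" "F \<notin> K i" "K i \<subseteq> K (Suc i)" by blast
    then show ?thesis
      using coset_mem_image_iff[OF primeideal.axioms(1)[OF pr] sub, of F i] by blast
  qed
  have "enat 2 \<le> krull_dim (type_ring Quot I)"
    unfolding krull_dim_def
    using primeideal_coset_image[OF pr sub] strict
    by (intro Sup_upper CollectI exI[of _ 2] exI[of _ "\<lambda>i. coset I ` K i"] conjI refl allI impI)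
  then show ?thesis by (simp add: numeral_eq_enat)
qed

text \<open>Here \<open>K\<close> is \<open>I + (f)\<close>, so \<open>f\<close> and \<open>f'\<close> form a regular sequence modulo \<open>I\<close>; the ideal \<open>Q\<close>
  witnesses that they generate a proper ideal.\<close>

lemma two_le_depth_quotient:
  assumes f: "\<And>g. f * g \<in> I \<Longrightarrow> g \<in> I"
    and K: "ideal K type_ring" "I \<subseteq> K" "f \<in> K" "\<And>g. g \<in> K \<Longrightarrow> \<exists>h. g - f * h \<in> I"
    and f': "\<And>g. f' * g \<in> K \<Longrightarrow> g \<in> K"
    and Q: "ideal Q type_ring" "I \<subseteq> Q" "f \<in> Q" "f' \<in> Q" "Q \<noteq> UNIV"
    and M: "f \<in> M" "f' \<in> M"
  shows "2 \<le> depth (type_ring Quot I) (coset I ` M)"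
proof -
  have gen0: "genideal (type_ring Quot I) {} = coset I ` I"
    using genideal_coset[of I "{}"] I by auto
  have gen1: "genideal (type_ring Quot I) {coset I f} = coset I ` K"
  proof -
    have "K \<subseteq> J" if J: "ideal J type_ring" "I \<subseteq> J" "f \<in> J" for J
    proof
      fix g assume "g \<in> K"
      then obtain h where "g - f * h \<in> J" using K(4) J(2) by blast
      then have "(g - f * h) + f * h \<in> J" using J ideal_add ideal_mult_right by blast
      then show "g \<in> J" by simp
    qed
    then show ?thesis using genideal_coset[OF K(1,2), of "{f}"] K(3) by auto
  qed
  have proper: "genideal (type_ring Quot I) {coset I f, coset I f'} \<noteq> carrier (type_ring Quot I)"
  proof
    assume eq: "genideal (type_ring Quot I) {coset I f, coset I f'} = carrier (type_ring Quot I)"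
    have "genideal (type_ring Quot I) {coset I f, coset I f'} \<subseteq> coset I ` Q"
      by (rule A.genideal_minimal[OF R.ring_ideal_imp_quot_ideal[OF I Q(1)]]) (use Q in blast)
    then have "coset I g \<in> coset I ` Q" for g using eq by (auto simp: carrier_quotient)
    then show False using coset_mem_image_iff[OF Q(1,2)] Q(5) by blast
  qed
  have "regular_sequence (type_ring Quot I) [coset I f, coset I f']"
    unfolding regular_sequence_def
  proof (intro conjI allI impI ballI)
    show "set [coset I f, coset I f'] \<subseteq> carrier (type_ring Quot I)" by (auto simp: carrier_quotient)
    show "genideal (type_ring Quot I) (set [coset I f, coset I f']) \<noteq> carrier (type_ring Quot I)"
      using proper by simp
    fix i g assume i: "i < length [coset I f, coset I f']" and "g \<in> carrier (type_ring Quot I)"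
      and prod: "[coset I f, coset I f'] ! i \<otimes>\<^bsub>type_ring Quot I\<^esub> g
        \<in> genideal (type_ring Quot I) (set (take i [coset I f, coset I f']))"
    then obtain G where G: "g = coset I G" by (auto simp: carrier_quotient)
    consider "i = 0" | "i = 1" using i by fastforce
    then show "g \<in> genideal (type_ring Quot I) (set (take i [coset I f, coset I f']))"
    proof cases
      case 1
      then show ?thesis
        using prod f[of G] by (simp add: gen0 G coset_mult coset_mem_image_iff[OF I])
    next
      case 2
      then show ?thesis
        using prod f'[of G] by (simp add: gen1 G coset_mult coset_mem_image_iff[OF K(1,2)])
    qed
  qed
  then have "enat (length [coset I f, coset I f']) \<le> depth (type_ring Quot I) (coset I ` M)"
    unfolding depth_def using M by (intro Sup_upper) fastforce
  then show ?thesis by (simp add: numeral_eq_enat numeral_2_eq_2)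
qed

end

section \<open>Ideals of cones over bihomogeneous point sets\<close>

definition vanishing_on :: "(2 + 'n::finite \<Rightarrow> 'k::field) set \<Rightarrow> ('n, 'k) bipoly set" where
  "vanishing_on W = {F. \<forall>x\<in>W. ev x F = 0}"

lemma ideal_vanishing_on: "ideal (vanishing_on W) coord_ring"
  by (auto simp: ideal_type_ring_iff vanishing_on_def)

text \<open>If \<open>F\<close> does not vanish at \<open>x\<close> and \<open>G\<close> does not vanish at \<open>y\<close>, then on the line through \<open>x\<close> and \<open>y\<close>
  they become nonzero univariate polynomials, whose product is nonzero.\<close>

lemma primeideal_vanishing_on:
  fixes W :: "(2 + 'n::finite \<Rightarrow> 'k::field_char_0) set"
  assumes "x0 \<in> W" and line: "\<And>x y t. x \<in> W \<Longrightarrow> y \<in> W \<Longrightarrow> (\<lambda>v. x v + t * (y v - x v)) \<in> W"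
  shows "primeideal (vanishing_on W) coord_ring"
proof (rule primeidealI[OF ideal_vanishing_on cring_from_type_algebra])
  have "1 \<notin> vanishing_on W" using assms(1) by (auto simp: vanishing_on_def)
  then show "carrier coord_ring \<noteq> vanishing_on W" by auto
  fix F G :: "('n, 'k) bipoly"
  assume "F \<otimes>\<^bsub>coord_ring\<^esub> G \<in> vanishing_on W"
  then have FG: "ev x F * ev x G = 0" if "x \<in> W" for x
    using that by (simp add: vanishing_on_def)
  show "F \<in> vanishing_on W \<or> G \<in> vanishing_on W"
  proof (rule ccontr)
    assume "\<not> ?thesis"
    then obtain x y where x: "x \<in> W" "ev x F \<noteq> 0" and y: "y \<in> W" "ev y G \<noteq> 0"
      by (auto simp: vanishing_on_def)
    define L where "L = (\<lambda>v. [:x v, y v - x v:])"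
    have "poly (up L F * up L G) t = 0" for t
      using FG[OF line[OF x(1) y(1), of t]] by (simp add: L_def)
    then have "up L F * up L G = 0" by (metis poly_0 poly_eq_poly_eq_iff ext)
    moreover have "poly (up L F) 0 \<noteq> 0" "poly (up L G) 1 \<noteq> 0"
      using x y by (simp_all add: L_def)
    ultimately show False by (metis mult_eq_0_iff poly_0)
  qed
qed

definition weight :: "('v::finite \<Rightarrow> nat) \<Rightarrow> ('v \<Rightarrow>\<^sub>0 nat) \<Rightarrow> nat" where
  "weight w m = (\<Sum>v\<in>UNIV. w v * Poly_Mapping.lookup m v)"

text \<open>Gradings by arbitrary weights of the variables. Weight 1 on the \<open>x\<close>-variables and 0 on the others
  gives the \<open>x\<close>-degree, and suitable other weights separate bidegrees.\<close>

definition component :: "(2 + 'n::finite \<Rightarrow> nat) \<Rightarrow> nat \<Rightarrow> ('n, 'k::field) bipoly \<Rightarrow> ('n, 'k) bipoly" where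
  "component w d F =
     (\<Sum>m\<in>{m\<in>Poly_Mapping.keys F. weight w m = d}. Poly_Mapping.single m (Poly_Mapping.lookup F m))"

lemma lookup_component:
  "Poly_Mapping.lookup (component w d F) m = (if weight w m = d then Poly_Mapping.lookup F m else 0)"
  by (auto simp: component_def lookup_sum lookup_single when_def sum.delta in_keys_iff)

lemma keys_component: "Poly_Mapping.keys (component w d F) = {m\<in>Poly_Mapping.keys F. weight w m = d}"
  by (auto simp: in_keys_iff lookup_component split: if_splits)

lemma sum_component: "F = (\<Sum>d\<in>weight w ` Poly_Mapping.keys F. component w d F)"
  by (rule poly_mapping_eqI) (auto simp: lookup_sum lookup_component sum.delta in_keys_iff)

lemma aeval_component_scale:
  "aeval h (\<lambda>v. t ^ w v * x v) (component w d F) = t ^ d * aeval h x (component w d F)"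
proof -
  have "(\<Prod>v\<in>UNIV. (t ^ w v * x v) ^ Poly_Mapping.lookup m v) =
      t ^ weight w m * (\<Prod>v\<in>UNIV. x v ^ Poly_Mapping.lookup m v)" for m
    by (simp add: power_mult_distrib prod.distrib weight_def power_sum power_mult)
  then show ?thesis
    by (simp add: aeval_def keys_component sum_distrib_left mult_ac)
qed

lemma component_poly:
  obtains p :: "'k::field poly"
  where "\<And>t. poly p t = ev (\<lambda>v. t ^ w v * x v) F" "\<And>d. coeff p d = ev x (component w d F)"
proof
  let ?D = "weight w ` Poly_Mapping.keys F"
  let ?p = "\<Sum>d\<in>?D. Polynomial.monom (ev x (component w d F)) d"
  show "poly ?p t = ev (\<lambda>v. t ^ w v * x v) F" for t
  proof -
    have "ev (\<lambda>v. t ^ w v * x v) F = (\<Sum>d\<in>?D. ev (\<lambda>v. t ^ w v * x v) (component w d F))"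
      by (subst ev.aeval_sum[symmetric]) (simp only: sum_component[symmetric])
    also have "\<dots> = (\<Sum>d\<in>?D. ev x (component w d F) * t ^ d)"
      by (rule sum.cong[OF refl]) (subst aeval_component_scale, rule mult.commute)
    finally show ?thesis by (simp add: poly_sum poly_monom)
  qed
  show "coeff ?p d = ev x (component w d F)" for d
  proof (cases "d \<in> ?D")
    case False
    then have "{m \<in> Poly_Mapping.keys F. weight w m = d} = {}" by auto
    then have "component w d F = 0" by (simp only: component_def sum.empty)
    with False show ?thesis by (simp add: coeff_sum sum.delta)
  qed (simp add: coeff_sum sum.delta)
qed

lemma ev_component_eq_0:
  fixes x :: "2 + 'n::finite \<Rightarrow> 'k::field_char_0"
  assumes "\<And>t. t \<noteq> 0 \<Longrightarrow> ev (\<lambda>v. t ^ w v * x v) F = 0"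
  shows "ev x (component w d F) = 0"
proof -
  obtain p where p: "\<And>t. poly p t = ev (\<lambda>v. t ^ w v * x v) F" "\<And>d. coeff p d = ev x (component w d F)"
    by (rule component_poly[where w = w and x = x and F = F]) (rule that)
  have "p = 0" by (rule poly_eq_0_if_cofinite[of "{0}"]) (use assms p in auto)
  then show ?thesis using p(2)[of d] by simp
qed

abbreviation bicone :: "(('k::field ^ 2) set \<times> ('k ^ 'n::finite) set) set \<Rightarrow> (2 + 'n \<Rightarrow> 'k) set" where
  "bicone Z \<equiv> {point a b | a b. \<exists>PQ\<in>Z. a \<in> fst PQ \<and> b \<in> snd PQ}"

lemma vanishes_at_iff: "(\<forall>PQ\<in>Z. vanishes_at F PQ) \<longleftrightarrow> F \<in> vanishing_on (bicone Z)"
  by (auto simp: vanishes_at_def vanishing_on_def eval_at_eq_ev)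

text \<open>The ideal generated by the bihomogeneous forms vanishing on \<open>Z\<close> contains every polynomial that
  vanishes on all coordinate vectors of \<open>Z\<close>: over an infinite field the bihomogeneous components of
  such a polynomial vanish as well, because the coordinates may be rescaled independently.\<close>

lemma vanishing_ideal_eq:
  fixes Z :: "(('k::field_char_0 ^ 2) set \<times> ('k ^ 'n::finite) set) set"
  assumes scale: "\<And>P Q a b c. (P, Q) \<in> Z \<Longrightarrow> a \<in> P \<Longrightarrow> b \<in> Q \<Longrightarrow> c \<noteq> 0 \<Longrightarrow> c *s a \<in> P \<and> c *s b \<in> Q"
  shows "vanishing_ideal Z = vanishing_on (bicone Z)"
proof
  interpret cring "coord_ring :: ('n, 'k) bipoly ring" by (rule cring_from_type_algebra)
  let ?gen = "{F. bihomogeneous F \<and> F \<in> vanishing_on (bicone Z)}"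
  have vi: "vanishing_ideal Z = genideal coord_ring ?gen"
    unfolding vanishing_ideal_def vanishes_at_iff ..
  show "vanishing_ideal Z \<subseteq> vanishing_on (bicone Z)"
    unfolding vi by (rule genideal_minimal[OF ideal_vanishing_on]) auto
  have id: "ideal (genideal coord_ring ?gen) coord_ring" by (rule genideal_ideal) simp
  show "vanishing_on (bicone Z) \<subseteq> vanishing_ideal Z"
  proof
    fix F assume F: "F \<in> vanishing_on (bicone Z)"
    \<comment> \<open>With \<open>N\<close> larger than every \<open>x\<close>-degree in \<open>F\<close>, the weight \<open>i + N * j\<close> determines the bidegree
      \<open>(i, j)\<close> (Kronecker substitution), so one parameter suffices to separate the components.\<close>
    define N where "N = Suc (\<Sum>m\<in>Poly_Mapping.keys F. fst (bidegree m))"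
    define w :: "2 + 'n \<Rightarrow> nat" where "w = case_sum (\<lambda>_. 1) (\<lambda>_. N)"
    have weight: "weight w m = fst (bidegree m) + N * snd (bidegree m)" for m
      by (simp add: weight_def w_def bidegree_def sum_distrib_left UNIV_Plus_UNIV[symmetric] sum.Plus
          del: UNIV_Plus_UNIV)
    have small: "fst (bidegree m) < N" if "m \<in> Poly_Mapping.keys F" for m
      using member_le_sum[OF that, of "\<lambda>m. fst (bidegree m)"] by (simp add: N_def)
    have "component w d F \<in> ?gen" for d
    proof -
      have "bidegree m = (d mod N, d div N)" if "m \<in> Poly_Mapping.keys (component w d F)" for m
      proof -
        have "fst (bidegree m) < N" "d = fst (bidegree m) + N * snd (bidegree m)"
          using that small[of m] weight[of m] by (auto simp: keys_component)
        then show ?thesis by (simp add: prod_eq_iff)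
      qed
      then have "bihomogeneous (component w d F)" unfolding bihomogeneous_def by blast
      moreover have "component w d F \<in> vanishing_on (bicone Z)"
        unfolding vanishing_on_def
      proof clarify
        fix P Q a b assume PQ: "(P, Q) \<in> Z" "a \<in> fst (P, Q)" "b \<in> snd (P, Q)"
        show "ev (point a b) (component w d F) = 0"
        proof (rule ev_component_eq_0)
          fix t :: 'k assume "t \<noteq> 0"
          then have "t *s a \<in> P" "t ^ N *s b \<in> Q"
            using scale PQ by auto
          moreover have "(\<lambda>v. t ^ w v * point a b v) = point (t *s a) (t ^ N *s b)"
            by (auto simp: w_def point_def fun_eq_iff split: sum.split)
          ultimately show "ev (\<lambda>v. t ^ w v * point a b v) F = 0"
            using F PQ(1) by (force simp: vanishing_on_def)
        qed
      qed
      ultimately show ?thesis by simp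
    qed
    then have "component w d F \<in> genideal coord_ring ?gen" for d
      using genideal_self[of ?gen] by (auto simp del: mem_Collect_eq)
    then show "F \<in> vanishing_ideal Z"
      unfolding vi by (subst sum_component[of F w]) (rule ideal_sum[OF id])
  qed
qed

text \<open>Any three polynomials satisfy a nontrivial relation on a finite union of planes. Among the
  \<open>N\<^sup>3\<close> monomials in \<open>F 0\<close>, \<open>F 1\<close>, \<open>F 2\<close> with exponents below \<open>N\<close>, all of degree linear in \<open>N\<close>, a
  combination vanishes on a plane as soon as it vanishes on a grid of \<open>O(N\<^sup>2)\<close> points of it. For
  large \<open>N\<close> there are more coefficients than such conditions.\<close>

lemma algebraic_relation_on_planes:
  fixes T :: "(('k::field_char_0 ^ 2) \<times> ('k ^ 'n::finite)) set" and F :: "nat \<Rightarrow> ('n, 'k) bipoly"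
  assumes T: "finite T"
  shows "\<exists>N c. (\<exists>x<N. \<exists>y<N. \<exists>z<N. c x y z \<noteq> 0) \<and>
    (\<forall>(a, b)\<in>T. \<forall>u v. ev (point (u *s a) (v *s b))
      (\<Sum>x<N. \<Sum>y<N. \<Sum>z<N. const (c x y z) * (F 0 ^ x * F 1 ^ y * F 2 ^ z)) = 0)"
proof -
  \<comment> \<open>\<open>D\<close> bounds the degrees of the three polynomials, and \<open>E\<close> exceeds the degree of every monomial
    in them with exponents below \<open>N\<close>. The choice of \<open>N\<close> makes \<open>card T * E\<^sup>2 < N\<^sup>3\<close>.\<close>
  define D where "D = (\<Sum>i<3. \<Sum>m\<in>Poly_Mapping.keys (F i). \<Sum>v\<in>UNIV. Poly_Mapping.lookup m v)"
  define N where "N = card T * (3 * D + 1)\<^sup>2 + 1"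
  define E where "E = N * (3 * D + 1)"
  have E: "3 * N * D < E" by (simp add: E_def N_def algebra_simps)
  define S where "S = {..<N} \<times> {..<N} \<times> {..<N}"
  define TT where "TT = T \<times> {..<E} \<times> {..<E}"
  define f :: "nat \<times> nat \<times> nat \<Rightarrow> _ \<Rightarrow> 'k" where
    "f = (\<lambda>(x, y, z) ((a, b), k, l). ev (point (of_nat k *s a) (of_nat l *s b)) (F 0 ^ x * F 1 ^ y * F 2 ^ z))"
  have "card TT = (card T * (3 * D + 1)\<^sup>2) * N\<^sup>2"
    by (simp add: TT_def card_cartesian_product E_def power2_eq_square algebra_simps)
  also have "\<dots> < N * N\<^sup>2" by (simp add: N_def)
  also have "\<dots> = card S" by (simp add: S_def card_cartesian_product power2_eq_square)
  finally have "\<exists>c. (\<exists>s\<in>S. c s \<noteq> 0) \<and> (\<forall>t\<in>TT. (\<Sum>s\<in>S. c s * f s t) = 0)"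
    using T by (intro nontrivial_solution) (auto simp: S_def TT_def)
  then obtain c where c: "\<exists>s\<in>S. c s \<noteq> 0" "\<And>t. t \<in> TT \<Longrightarrow> (\<Sum>s\<in>S. c s * f s t) = 0" by blast
  define G where "G = (\<Sum>x<N. \<Sum>y<N. \<Sum>z<N. const (c (x, y, z)) * (F 0 ^ x * F 1 ^ y * F 2 ^ z))"
  have grid: "ev (point (of_nat k *s a) (of_nat l *s b)) G = 0" if "(a, b) \<in> T" "k < E" "l < E" for a b k l
    using c(2)[of "((a, b), k, l)"] that
    by (simp add: G_def S_def TT_def f_def sum.cartesian_product case_prod_unfold)
  have deg: "Polynomial.degree (up Y G) < E" if Y: "\<And>v. Polynomial.degree (Y v) \<le> 1" for Y :: "2 + 'n \<Rightarrow> 'k poly"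
  proof -
    have F: "Polynomial.degree (up Y (F i) ^ x) \<le> N * D" if "i < 3" "x < N" for i x
    proof -
      have "Polynomial.degree (up Y (F i)) \<le> D"
      proof (rule degree_up_le)
        fix m assume m: "m \<in> Poly_Mapping.keys (F i)"
        have "(\<Sum>v\<in>UNIV. Poly_Mapping.lookup m v * Polynomial.degree (Y v)) \<le> (\<Sum>v\<in>UNIV. Poly_Mapping.lookup m v * 1)"
          using Y by (intro sum_mono mult_le_mono2)
        also have "\<dots> \<le> (\<Sum>m\<in>Poly_Mapping.keys (F i). \<Sum>v\<in>UNIV. Poly_Mapping.lookup m v)"
          using member_le_sum[OF m, of "\<lambda>m. \<Sum>v\<in>UNIV. Poly_Mapping.lookup m v"] by simp
        also have "\<dots> \<le> D"
          unfolding D_def using that(1)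
          by (intro member_le_sum[of i "{..<3}" "\<lambda>i. \<Sum>m\<in>Poly_Mapping.keys (F i). \<Sum>v\<in>UNIV. Poly_Mapping.lookup m v"]) auto
        finally show "(\<Sum>v\<in>UNIV. Poly_Mapping.lookup m v * Polynomial.degree (Y v)) \<le> D" .
      qed
      then have "Polynomial.degree (up Y (F i)) * x \<le> D * N"
        using that(2) by (intro mult_mono) auto
      then show ?thesis
        using degree_power_le[of "up Y (F i)" x] by (simp add: mult.commute)
    qed
    have "Polynomial.degree (up Y G) \<le> 3 * N * D"
      unfolding G_def up.aeval_sum
    proof (intro degree_sum_le finite_lessThan)
      fix x y z assume "x \<in> {..<N}" "y \<in> {..<N}" "z \<in> {..<N}"
      then have "Polynomial.degree (up Y (F 0) ^ x * up Y (F 1) ^ y * up Y (F 2) ^ z) \<le> N * D + N * D + N * D"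
        by (intro order.trans[OF degree_mult_le] add_mono F) auto
      then show "Polynomial.degree (up Y (const (c (x, y, z)) * (F 0 ^ x * F 1 ^ y * F 2 ^ z))) \<le> 3 * N * D"
        by (auto intro: order.trans[OF degree_smult_le])
    qed
    with E show ?thesis by simp
  qed
  \<comment> \<open>A polynomial of degree below \<open>E\<close> with \<open>E\<close> distinct roots \<open>0, 1, \<dots>, E - 1\<close> vanishes.\<close>
  have zero: "poly (up Y G) t = 0"
    if Y: "\<And>v. Polynomial.degree (Y v) \<le> 1" and "\<And>k. k < E \<Longrightarrow> poly (up Y G) (of_nat k) = 0" for Y :: "2 + 'n \<Rightarrow> 'k poly" and t
  proof -
    have "up Y G = 0"
    proof (rule poly_eqI_degree[of "of_nat ` {..<E}"])
      have "card ((of_nat :: nat \<Rightarrow> 'k) ` {..<E}) = E"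
        by (subst card_image) (auto intro: inj_onI)
      then show "card ((of_nat :: nat \<Rightarrow> 'k) ` {..<E}) > Polynomial.degree (up Y G)"
        "card ((of_nat :: nat \<Rightarrow> 'k) ` {..<E}) > Polynomial.degree (0 :: 'k poly)"
        using deg[OF Y] by (auto simp: E_def N_def)
    qed (use that in auto)
    then show ?thesis by simp
  qed
  have "ev (point (u *s a) (v *s b)) G = 0" if ab: "(a, b) \<in> T" for a b u v
  proof -
    have row: "ev (point (u *s a) (of_nat l *s b)) G = 0" if "l < E" for u l
    proof -
      define Y where "Y = case_sum (\<lambda>i. [:0, a $ i:]) (\<lambda>j. [:of_nat l * b $ j:])"
      have Y: "(\<lambda>v. poly (Y v) u) = point (u *s a) (of_nat l *s b)" for u
        by (auto simp: Y_def fun_eq_iff point_def split: sum.split)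
      have "Polynomial.degree (Y v) \<le> 1" for v by (simp add: Y_def split: sum.split)
      then have "poly (up Y G) u = 0"
        by (rule zero) (use grid[OF ab _ that] in \<open>simp add: Y\<close>)
      then show ?thesis by (simp add: Y)
    qed
    define Y where "Y = case_sum (\<lambda>i. [:u * a $ i:]) (\<lambda>j. [:0, b $ j:])"
    have Y: "(\<lambda>w. poly (Y w) v) = point (u *s a) (v *s b)" for v
      by (auto simp: Y_def fun_eq_iff point_def split: sum.split)
    have "Polynomial.degree (Y w) \<le> 1" for w by (simp add: Y_def split: sum.split)
    then have "poly (up Y G) v = 0"
      by (rule zero) (use row in \<open>simp add: Y\<close>)
    then show ?thesis by (simp add: Y)
  qed
  moreover have "\<exists>x<N. \<exists>y<N. \<exists>z<N. c (x, y, z) \<noteq> 0" using c(1) by (auto simp: S_def)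
  ultimately show ?thesis unfolding G_def by (intro exI[of _ N] exI[of _ "\<lambda>x y z. c (x, y, z)"]) auto
qed

section \<open>The staircase configuration\<close>

definition xweight :: "2 + 'n \<Rightarrow> nat" where
  "xweight = case_sum (\<lambda>_. 1) (\<lambda>_. 0)"

lemma xweight_simps [simp]: "xweight (Inl i) = 1" "xweight (Inr j) = 0"
  by (simp_all add: xweight_def)

lemma scale_point:
  fixes t :: "'k::field"
  shows "(\<lambda>v. t ^ xweight v * point a b v) = point (t *s a) b"
  by (auto simp: point_def xweight_def fun_eq_iff split: sum.split)

text \<open>In the coordinates \<open>L = x\<^sub>0 - c x\<^sub>1\<close> and \<open>x\<^sub>1\<close> of the projective line this is the point with \<open>L = 1\<close>
  and \<open>x\<^sub>1 = t\<close>; the index 1 of the type \<open>2\<close> stands for \<open>x\<^sub>0\<close> and the index 2 for \<open>x\<^sub>1\<close>.\<close>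

definition affine_point :: "'k::field \<Rightarrow> 'k \<Rightarrow> 'k ^ 2" where
  "affine_point c t = (\<chi> k. if k = 1 then 1 + c * t else t)"

text \<open>After the choice of a form \<open>L\<close> that vanishes at none of the points of the projective line, those
  points are given by distinct affine coordinates \<open>p i\<close>, and each point of the other factor by one
  coordinate vector \<open>q j\<close>. The vector \<open>w\<close> holds the coefficients of a linear form that vanishes at
  none of the \<open>q j\<close>.\<close>

locale staircase =
  fixes r :: nat and l :: "nat \<Rightarrow> nat" and p :: "nat \<Rightarrow> 'k::field_char_0" and c :: 'k
    and q :: "nat \<Rightarrow> 'k ^ 'n::finite" and w :: "'k ^ 'n"
  assumes r: "1 \<le> r" and l: "1 \<le> l 1"
    and antimono: "\<And>i j. 1 \<le> i \<Longrightarrow> i \<le> j \<Longrightarrow> j \<le> r \<Longrightarrow> l j \<le> l i"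
    and inj: "inj_on p {1..r}"
    and form_nz: "\<And>j. 1 \<le> j \<Longrightarrow> j \<le> l 1 \<Longrightarrow> (\<Sum>i\<in>UNIV. w $ i * q j $ i) \<noteq> 0"
begin

abbreviation base :: "'k \<Rightarrow> 'k ^ 2" where
  "base \<equiv> affine_point c"

text \<open>A coordinate vector of the point at infinity of the chart, where the form \<open>L\<close> vanishes.\<close>

definition infty :: "'k ^ 2" where
  "infty = (\<chi> k. if k = 1 then c else 1)"

definition cone :: "(2 + 'n \<Rightarrow> 'k) set" where
  "cone = {point (u *s base (p i)) (v *s q j) | u v i j.
     u \<noteq> 0 \<and> v \<noteq> 0 \<and> 1 \<le> i \<and> i \<le> r \<and> 1 \<le> j \<and> j \<le> l i}"

definition xform :: "('n, 'k) bipoly" where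
  "xform = poly_var (Inl 1) - const c * poly_var (Inl 2)"

definition yform :: "('n, 'k) bipoly" where
  "yform = (\<Sum>j\<in>UNIV. const (w $ j) * poly_var (Inr j))"

definition xcomp :: "nat \<Rightarrow> ('n, 'k) bipoly \<Rightarrow> ('n, 'k) bipoly" where
  "xcomp = component xweight"

text \<open>The sum of the ideal of the cone and the principal ideal of \<open>xform\<close>.\<close>

definition sum_ideal :: "('n, 'k) bipoly set" where
  "sum_ideal = {G. \<exists>h. G - xform * h \<in> vanishing_on cone}"

lemma ev_xform: "ev (point a b) xform = a $ 1 - c * a $ 2"
  by (simp add: xform_def)

lemma ev_yform: "ev (point a b) yform = (\<Sum>j\<in>UNIV. w $ j * b $ j)"
  by (simp add: yform_def)

lemma yform_nz: "1 \<le> i \<Longrightarrow> i \<le> r \<Longrightarrow> 1 \<le> j \<Longrightarrow> j \<le> l i \<Longrightarrow> v \<noteq> 0 \<Longrightarrow> ev (point a (v *s q j)) yform \<noteq> 0"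
proof -
  assume *: "1 \<le> i" "i \<le> r" "1 \<le> j" "j \<le> l i" "v \<noteq> 0"
  have "ev (point a (v *s q j)) yform = v * (\<Sum>i\<in>UNIV. w $ i * q j $ i)"
    by (simp add: ev_yform sum_distrib_left mult_ac)
  then show ?thesis using form_nz[of j] antimono[of 1 i] * by simp
qed

lemma ev_xcomp_scale: "ev (point (t *s a) b) (xcomp m F) = t ^ m * ev (point a b) (xcomp m F)"
  using aeval_component_scale[of "\<lambda>c. c" t xweight "point a b" m F]
  by (simp only: scale_point xcomp_def)

lemma xcomp_poly:
  obtains g :: "'k poly"
  where "\<And>t. poly g t = ev (point (t *s a) b) F" "\<And>m. coeff g m = ev (point a b) (xcomp m F)"
  by (rule component_poly[where w = xweight and x = "point a b" and F = F],
      rule that) (simp_all add: scale_point xcomp_def)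

lemma ideal_sum_ideal: "ideal sum_ideal type_ring"
proof -
  note I = ideal_vanishing_on[of cone]
  show ?thesis
    unfolding ideal_type_ring_iff
  proof (intro conjI ballI allI)
    show "0 \<in> sum_ideal" using ideal_zero[OF I] by (auto simp: sum_ideal_def intro: exI[of _ 0])
  next
    fix F G assume "F \<in> sum_ideal" "G \<in> sum_ideal"
    then obtain h k where "F - xform * h \<in> vanishing_on cone" "G - xform * k \<in> vanishing_on cone"
      by (auto simp: sum_ideal_def)
    from ideal_add[OF I this] have "(F + G) - xform * (h + k) \<in> vanishing_on cone"
      by (simp add: algebra_simps)
    then show "F + G \<in> sum_ideal" unfolding sum_ideal_def by blast
  next
    fix F G assume "F \<in> sum_ideal"
    then obtain h where "F - xform * h \<in> vanishing_on cone" by (auto simp: sum_ideal_def)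
    from ideal_mult_left[OF I this, of G] have "G * F - xform * (G * h) \<in> vanishing_on cone"
      by (simp add: algebra_simps)
    then show "G * F \<in> sum_ideal" unfolding sum_ideal_def by blast
  qed
qed

lemma vanishing_subset_sum_ideal: "vanishing_on cone \<subseteq> sum_ideal"
  by (auto simp: sum_ideal_def intro: exI[of _ 0])

lemma xform_mem_sum_ideal: "xform \<in> sum_ideal"
  using ideal_zero[OF ideal_vanishing_on[of cone]] by (auto simp: sum_ideal_def intro!: exI[of _ 1])

text \<open>Fix the coordinate vector of a point \<open>Q\<^sub>j\<close> and let \<open>m = i - 1\<close>. The component of \<open>x\<close>-degree \<open>m\<close> of \<open>H\<close>,
  read in the affine chart, is a polynomial of degree at most \<open>m\<close>. It has the \<open>m + 1\<close> distinct roots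
  \<open>p 1, \<dots>, p i\<close>, because the column of \<open>j\<close> in the staircase has height at least \<open>i\<close>. So it is zero,
  and the homogeneous form vanishes at infinity too.\<close>

lemma xcomp_vanishes_at_infty:
  assumes H: "H \<in> vanishing_on cone" and i: "1 \<le> i" "i \<le> r" and j: "1 \<le> j" "j \<le> l i" and v: "v \<noteq> 0"
  shows "ev (point infty (v *s q j)) (xcomp (i - 1) H) = 0"
proof -
  define b where "b = v *s q j"
  define m where "m = i - 1"
  have root: "ev (point (base (p i')) b) (xcomp m H) = 0" if "1 \<le> i'" "i' \<le> i" for i'
  proof -
    have "j \<le> l i'" using antimono[of i' i] that i j by simp
    then have "point (t *s base (p i')) b \<in> cone" if "t \<noteq> 0" for t
      unfolding cone_def b_def using that \<open>1 \<le> i'\<close> \<open>i' \<le> i\<close> i j v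
      by (intro CollectI exI[of _ t] exI[of _ v] exI[of _ i'] exI[of _ j]) simp
    then have "ev (point (t *s base (p i')) b) H = 0" if "t \<noteq> 0" for t
      using H that by (simp add: vanishing_on_def)
    then show ?thesis unfolding xcomp_def by (intro ev_component_eq_0) (simp only: scale_point)
  qed
  define Y where "Y = case_sum (\<lambda>k::2. if k = 1 then [:1, c:] else [:0, 1:]) (\<lambda>j. [:b $ j:])"
  have Y: "(\<lambda>v. poly (Y v) t) = point (base t) b" for t
    by (auto simp: Y_def point_def affine_point_def fun_eq_iff split: sum.split)
  have "Polynomial.degree (up Y (xcomp m H)) \<le> m"
  proof (rule degree_up_le)
    fix k assume "k \<in> Poly_Mapping.keys (xcomp m H)"
    then have "m = weight xweight k" by (simp add: xcomp_def keys_component)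
    also have "\<dots> \<ge> (\<Sum>v\<in>UNIV. Poly_Mapping.lookup k v * Polynomial.degree (Y v))"
      unfolding weight_def by (intro sum_mono) (auto simp: Y_def xweight_def split: sum.split)
    finally show "(\<Sum>v\<in>UNIV. Poly_Mapping.lookup k v * Polynomial.degree (Y v)) \<le> m" .
  qed
  moreover have "card (p ` {1..i}) = Suc m"
    using card_image[OF inj_on_subset[OF inj, of "{1..i}"]] i by (simp add: m_def)
  ultimately have "up Y (xcomp m H) = 0"
    by (intro poly_eqI_degree[of "p ` {1..i}"]) (auto simp: Y root)
  then have affine: "ev (point (base t) b) (xcomp m H) = 0" for t
    using poly_up[of Y "xcomp m H" t] by (simp add: Y)
  \<comment> \<open>The line \<open>s \<mapsto> (s + c, 1)\<close> meets the chart for \<open>s \<noteq> 0\<close> and passes through infinity at \<open>s = 0\<close>.\<close>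
  define Y' where "Y' = case_sum (\<lambda>k::2. if k = 1 then [:c, 1:] else [:1:]) (\<lambda>j. [:b $ j:])"
  have "up Y' (xcomp m H) = 0"
  proof (rule poly_eq_0_if_cofinite[of "{0}"])
    fix s :: 'k assume "s \<notin> {0}"
    then have "(\<lambda>v. poly (Y' v) s) = point (s *s base (1 / s)) b"
      by (auto simp: Y'_def point_def affine_point_def fun_eq_iff field_simps split: sum.split)
    then show "poly (up Y' (xcomp m H)) s = 0"
      by (simp add: ev_xcomp_scale affine)
  qed simp
  moreover have "(\<lambda>v. poly (Y' v) 0) = point infty b"
    by (auto simp: Y'_def point_def infty_def fun_eq_iff split: sum.split)
  ultimately show ?thesis
    using poly_up[of Y' "xcomp m H" 0] by (simp add: b_def m_def)
qed

lemma xcomp_mult_yform: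
  "ev (point a b) (xcomp m (yform * G)) = (\<Sum>j\<in>UNIV. w $ j * b $ j) * ev (point a b) (xcomp m G)"
proof -
  obtain g where g: "\<And>t. poly g t = ev (point (t *s a) b) G" "\<And>m. coeff g m = ev (point a b) (xcomp m G)"
    by (rule xcomp_poly) (rule that)
  obtain g' where g': "\<And>t. poly g' t = ev (point (t *s a) b) (yform * G)"
    "\<And>m. coeff g' m = ev (point a b) (xcomp m (yform * G))"
    by (rule xcomp_poly) (rule that)
  have "g' = smult (\<Sum>j\<in>UNIV. w $ j * b $ j) g"
    unfolding poly_eq_poly_eq_iff[symmetric] by (auto simp: g g' ev_yform)
  then show ?thesis using g(2)[of m] g'(2)[of m] by simp
qed

lemma xcomp_mult_xform: "ev (point infty b) (xcomp m (xform * h)) = 0"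
proof -
  obtain g where g: "\<And>t. poly g t = ev (point (t *s infty) b) (xform * h)"
    "\<And>m. coeff g m = ev (point infty b) (xcomp m (xform * h))"
    by (rule xcomp_poly) (rule that)
  have "poly g t = 0" for t by (simp add: g ev_xform infty_def)
  then have "g = 0" by (metis poly_0 poly_eq_poly_eq_iff ext)
  then show ?thesis using g(2)[of m] by simp
qed

lemma xcomp_diff: "xcomp m (F - G) = xcomp m F - xcomp m G"
  unfolding xcomp_def by (rule poly_mapping_eqI) (simp add: lookup_component lookup_minus)

text \<open>The key step. Restricted to \<open>L = 0\<close>, a polynomial becomes \<open>\<Sum>\<^sub>m x\<^sub>1\<^sup>m g\<^sub>m\<close> with \<open>g\<^sub>m\<close> in the \<open>y\<close>-variables, and
  membership in the sum ideal means exactly that each \<open>g\<^sub>m\<close> vanishes at the points of row \<open>m + 1\<close> of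
  the staircase. Conversely, given that vanishing, \<open>x\<^sub>1\<^sup>m g\<^sub>m\<close> is congruent modulo \<open>L\<close> to
  \<open>g\<^sub>m\<close> times the product of \<open>x\<^sub>1 - p\<^sub>i L\<close> over \<open>i \<le> m\<close>. The product vanishes on the first \<open>m\<close> rows, and \<open>g\<^sub>m\<close> on all
  later rows, because the rows of a staircase are nested.\<close>

lemma mem_sum_ideal_iff:
  "G \<in> sum_ideal \<longleftrightarrow> (\<forall>i j v. 1 \<le> i \<and> i \<le> r \<and> 1 \<le> j \<and> j \<le> l i \<and> v \<noteq> 0 \<longrightarrow>
     ev (point infty (v *s q j)) (xcomp (i - 1) G) = 0)" (is "_ \<longleftrightarrow> ?cond")
proof
  assume "G \<in> sum_ideal"
  then obtain h where h: "G - xform * h \<in> vanishing_on cone" by (auto simp: sum_ideal_def)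
  show ?cond
    using xcomp_vanishes_at_infty[OF h] by (simp add: xcomp_diff xcomp_mult_xform)
next
  assume cond: ?cond
  note S = ideal_sum_ideal
  let ?x = "poly_var (Inl 2) :: ('n, 'k) bipoly"
  have "xcomp m G \<in> sum_ideal" for m
  proof -
    \<comment> \<open>Setting the \<open>x\<close>-variables to the coordinates of the point at infinity turns the component of
      \<open>x\<close>-degree \<open>m\<close> into \<open>g\<^sub>m\<close>.\<close>
    define Yz :: "2 + 'n \<Rightarrow> ('n, 'k) bipoly"
      where "Yz = case_sum (\<lambda>k. const (infty $ k)) (\<lambda>j. poly_var (Inr j))"
    define g where "g = aeval const Yz (xcomp m G)"
    define prd where "prd = (\<Prod>i\<in>{1..m}. ?x - const (p i) * xform)"
    have ev_g: "ev (point a b) g = ev (point infty b) (xcomp m G)" for a b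
    proof -
      have "(\<lambda>v. ev (point a b) (Yz v)) = point infty b"
        by (auto simp: Yz_def fun_eq_iff point_def split: sum.split)
      then show ?thesis by (simp add: g_def)
    qed
    have 1: "xcomp m G - ?x ^ m * g \<in> sum_ideal"
    proof -
      have "poly_var v - ?x ^ xweight v * Yz v \<in> sum_ideal" for v
      proof (cases v)
        case (Inl k)
        then show ?thesis
          using exhaust_2[of k] xform_mem_sum_ideal ideal_zero[OF S]
          by (auto simp: Yz_def infty_def xform_def mult.commute)
      next
        case (Inr j)
        then show ?thesis using ideal_zero[OF S] by (simp add: Yz_def)
      qed
      then have "aeval const poly_var (xcomp m G) - aeval const (\<lambda>v. ?x ^ xweight v * Yz v) (xcomp m G) \<in> sum_ideal"
        by (rule ideal_aeval_cong[OF S])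
      then show ?thesis unfolding aeval_const_poly_var g_def xcomp_def aeval_component_scale .
    qed
    have "(\<Prod>i\<in>{1..m}. ?x) - prd \<in> sum_ideal"
      unfolding prd_def
      by (rule ideal_prod_cong[OF S]) (auto intro: ideal_mult_left[OF S] xform_mem_sum_ideal)
    then have 2: "?x ^ m - prd \<in> sum_ideal" by simp
    have "prd * g \<in> vanishing_on cone"
      unfolding vanishing_on_def cone_def
    proof clarify
      fix u v :: 'k and i j assume *: "u \<noteq> 0" "v \<noteq> 0" "1 \<le> i" "i \<le> r" "1 \<le> j" "j \<le> l i"
      show "ev (point (u *s base (p i)) (v *s q j)) (prd * g) = 0"
      proof (cases "i \<le> m")
        case True
        have "ev (point (u *s base (p i)) (v *s q j)) (?x - const (p i) * xform) = 0"
          by (simp add: ev_xform affine_point_def algebra_simps)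
        then have "ev (point (u *s base (p i)) (v *s q j)) prd = 0"
          unfolding prd_def ev.aeval_prod using True *(3) by (intro prod_zero) auto
        then show ?thesis by simp
      next
        case False
        then have "j \<le> l (Suc m)" "Suc m \<le> r" using antimono[of "Suc m" i] * by auto
        then have "ev (point infty (v *s q j)) (xcomp (Suc m - 1) G) = 0"
          using cond * by (metis le_add1 plus_1_eq_Suc)
        then show ?thesis by (simp add: ev_g)
      qed
    qed
    then have 3: "prd * g \<in> sum_ideal" using vanishing_subset_sum_ideal by blast
    have "xcomp m G = (xcomp m G - ?x ^ m * g) + ((?x ^ m - prd) * g + prd * g)"
      by (simp add: algebra_simps)
    also have "\<dots> \<in> sum_ideal" by (intro ideal_add[OF S] 1 3 ideal_mult_right[OF S] 2)
    finally show ?thesis .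
  qed
  then show "G \<in> sum_ideal"
    unfolding xcomp_def by (subst sum_component[of G xweight]) (rule ideal_sum[OF S])
qed

lemma xform_regular:
  assumes "xform * G \<in> vanishing_on cone"
  shows "G \<in> vanishing_on cone"
  unfolding vanishing_on_def
proof clarify
  fix x assume x: "x \<in> cone"
  then have "ev x xform \<noteq> 0" by (auto simp: cone_def ev_xform affine_point_def algebra_simps)
  moreover have "ev x xform * ev x G = 0" using assms x by (simp add: vanishing_on_def)
  ultimately show "ev x G = 0" by simp
qed

text \<open>Multiplication by a form in the \<open>y\<close>-variables multiplies each \<open>g\<^sub>m\<close> by that form, which is nonzero
  at all points in question.\<close>

lemma yform_regular:
  assumes "yform * G \<in> sum_ideal"
  shows "G \<in> sum_ideal"
  unfolding mem_sum_ideal_iff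
proof clarify
  fix i j and v :: 'k
  assume *: "1 \<le> i" "i \<le> r" "1 \<le> j" "j \<le> l i" "v \<noteq> 0"
  have "ev (point infty (v *s q j)) yform * ev (point infty (v *s q j)) (xcomp (i - 1) G) = 0"
    using assms * unfolding mem_sum_ideal_iff xcomp_mult_yform ev_yform by blast
  then show "ev (point infty (v *s q j)) (xcomp (i - 1) G) = 0"
    using yform_nz[OF *] by simp
qed

lemma quotient_krull_dim_depth:
  fixes I :: "('n, 'k) bipoly set"
  assumes I: "I = vanishing_on cone"
  shows "krull_dim (coord_ring Quot I) = 2"
    and "depth (coord_ring Quot I) (coset I ` irrelevant_ideal) = 2"
proof -
  have id: "ideal I coord_ring" unfolding I by (rule ideal_vanishing_on)
  have C: "const 0 = (0 :: ('n, 'k) bipoly)" "const 1 = (1 :: ('n, 'k) bipoly)"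
    "const (x * y) = (const x * const y :: ('n, 'k) bipoly)" for x y :: 'k
    by (simp_all add: mult_single)
  have rel: "\<exists>N c. (\<exists>x<N. \<exists>y<N. \<exists>z<N. c x y z \<noteq> 0) \<and>
      (\<Sum>x<N. \<Sum>y<N. \<Sum>z<N. const (c x y z) * (F 0 ^ x * F 1 ^ y * F 2 ^ z)) \<in> I"
    for F :: "nat \<Rightarrow> ('n, 'k) bipoly"
  proof -
    define T where "T = (\<lambda>(i, j). (base (p i), q j)) ` (SIGMA i:{1..r}. {1..l i})"
    define rel where "rel N c =
      (\<Sum>x<N. \<Sum>y<N. \<Sum>z<N. const (c x y z) * (F 0 ^ x * F 1 ^ y * F 2 ^ z))" for N and c :: "nat \<Rightarrow> nat \<Rightarrow> nat \<Rightarrow> 'k"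
    have "finite T" unfolding T_def by auto
    from algebraic_relation_on_planes[OF this, of F, folded rel_def]
    obtain N c where nz: "\<exists>x<N. \<exists>y<N. \<exists>z<N. c x y z \<noteq> 0"
      and van: "\<forall>(a, b)\<in>T. \<forall>u v. ev (point (u *s a) (v *s b)) (rel N c) = 0"
      by blast
    have "rel N c \<in> I"
      unfolding I vanishing_on_def cone_def
    proof clarify
      fix u v :: 'k and i j assume "1 \<le> i" "i \<le> r" "1 \<le> j" "j \<le> l i"
      then have "(base (p i), q j) \<in> T" by (force simp: T_def)
      with van show "ev (point (u *s base (p i)) (v *s q j)) (rel N c) = 0" by blast
    qed
    with nz show ?thesis unfolding rel_def by blast
  qed
  define a where "a = base (p 1)"
  define b where "b = q 1"
  \<comment> \<open>The plane over one point of the configuration, a line in it and the origin have vanishing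
    ideals that form a chain of primes of length 2.\<close>
  define W0 where "W0 = {point (u *s a) (v *s b) | u v. True}"
  define W1 where "W1 = {point 0 (v *s b) | v. True}"
  define W2 :: "(2 + 'n \<Rightarrow> 'k) set" where "W2 = {point 0 0}"
  have prime: "primeideal (vanishing_on W0) coord_ring" "primeideal (vanishing_on W1) coord_ring"
    "primeideal (vanishing_on W2) coord_ring"
  proof -
    have line: "(\<lambda>x. point (u *s a) (v *s b) x + t * (point (u' *s a) (v' *s b) x - point (u *s a) (v *s b) x)) =
        point ((u + t * (u' - u)) *s a) ((v + t * (v' - v)) *s b)" for u u' v v' t
      by (auto simp: point_def fun_eq_iff algebra_simps split: sum.split)
    show "primeideal (vanishing_on W0) coord_ring"
    proof (rule primeideal_vanishing_on)
      show "point (0 *s a) (0 *s b) \<in> W0" unfolding W0_def by blast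
      fix x y t assume "x \<in> W0" "y \<in> W0"
      then obtain u v u' v' where "x = point (u *s a) (v *s b)" "y = point (u' *s a) (v' *s b)"
        unfolding W0_def by blast
      then show "(\<lambda>i. x i + t * (y i - x i)) \<in> W0" unfolding W0_def using line by blast
    qed
    have W1: "W1 = {point (0 *s a) (v *s b) | v. True}" unfolding W1_def by simp
    show "primeideal (vanishing_on W1) coord_ring"
    proof (rule primeideal_vanishing_on)
      show "point (0 *s a) (0 *s b) \<in> W1" unfolding W1 by blast
      fix x y t assume "x \<in> W1" "y \<in> W1"
      then obtain v v' where "x = point (0 *s a) (v *s b)" "y = point (0 *s a) (v' *s b)"
        unfolding W1 by blast
      then have "(\<lambda>i. x i + t * (y i - x i)) = point ((0 + t * (0 - 0)) *s a) ((v + t * (v' - v)) *s b)"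
        by (simp only: line)
      also have "\<dots> = point 0 ((v + t * (v' - v)) *s b)" by simp
      finally show "(\<lambda>i. x i + t * (y i - x i)) \<in> W1" unfolding W1_def by blast
    qed
    show "primeideal (vanishing_on W2) coord_ring"
      by (rule primeideal_vanishing_on[of "point 0 0"]) (auto simp: W2_def)
  qed
  have b: "(\<Sum>i\<in>UNIV. w $ i * b $ i) \<noteq> 0" unfolding b_def using form_nz[of 1] l by simp
  have IW0: "I \<subseteq> vanishing_on W0"
  proof
    fix F assume F: "F \<in> I"
    have "ev (point (u *s a) (v *s b)) F = 0" for u v
    proof -
      define Y where "Y = case_sum (\<lambda>i::2. [:u * a $ i, a $ i:]) (\<lambda>j. [:v * b $ j, b $ j:])"
      have Y: "(\<lambda>x. poly (Y x) t) = point ((u + t) *s a) ((v + t) *s b)" for t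
        by (auto simp: Y_def point_def fun_eq_iff algebra_simps split: sum.split)
      have "up Y F = 0"
      \<comment> \<open>The diagonal line through the given point of the plane stays in the cone for all but two
          parameters.\<close>
      proof (rule poly_eq_0_if_cofinite[of "{- u, - v}"])
        fix t assume "t \<notin> {- u, - v}"
        then have "u + t \<noteq> 0" "v + t \<noteq> 0" by (auto simp: add_eq_0_iff)
        then have "point ((u + t) *s a) ((v + t) *s b) \<in> cone"
          unfolding cone_def a_def b_def using r l by blast
        then show "poly (up Y F) t = 0" using F by (simp add: I vanishing_on_def Y)
      qed simp
      then show ?thesis using Y[of 0] poly_up[of Y F 0] by simp
    qed
    then show "F \<in> vanishing_on W0" by (auto simp: vanishing_on_def W0_def)
  qed
  have W01: "vanishing_on W0 \<subset> vanishing_on W1"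
  proof
    show "vanishing_on W0 \<subseteq> vanishing_on W1"
    proof -
      have "point (0 *s a) (v *s b) \<in> W0" for v unfolding W0_def by blast
      then have "W1 \<subseteq> W0" by (auto simp: W1_def)
      then show ?thesis by (auto simp: vanishing_on_def)
    qed
    have "xform \<in> vanishing_on W1" by (auto simp: vanishing_on_def W1_def ev_xform)
    moreover have "point (1 *s a) (1 *s b) \<in> W0" unfolding W0_def by blast
    moreover have "ev (point (1 *s a) (1 *s b)) xform \<noteq> 0"
      by (simp add: ev_xform a_def affine_point_def)
    ultimately show "vanishing_on W0 \<noteq> vanishing_on W1" unfolding vanishing_on_def by blast
  qed
  have W12: "vanishing_on W1 \<subset> vanishing_on W2"
  proof
    show "vanishing_on W1 \<subseteq> vanishing_on W2"
    proof -
      have "point 0 (0 *s b) \<in> W1" unfolding W1_def by blast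
      then have "W2 \<subseteq> W1" by (simp add: W2_def)
      then show ?thesis by (auto simp: vanishing_on_def)
    qed
    have "yform \<in> vanishing_on W2" by (auto simp: vanishing_on_def W2_def ev_yform)
    moreover have "point 0 (1 *s b) \<in> W1" unfolding W1_def by blast
    moreover have "ev (point 0 (1 *s b)) yform \<noteq> 0"
      using b by (simp add: ev_yform)
    ultimately show "vanishing_on W1 \<noteq> vanishing_on W2" unfolding vanishing_on_def by blast
  qed
  show "krull_dim (coord_ring Quot I) = 2"
    by (intro antisym krull_dim_quotient_le[OF id C rel] two_le_krull_dim_quotient[OF id prime IW0 W01 W12])
  have irr: "xform \<in> irrelevant_ideal" "yform \<in> irrelevant_ideal"
  proof -
    interpret cring "coord_ring :: ('n, 'k) bipoly ring" by (rule cring_from_type_algebra)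
    have id: "ideal (irrelevant_ideal :: ('n, 'k) bipoly set) coord_ring"
      unfolding irrelevant_ideal_def by (rule genideal_ideal) simp
    have var: "poly_var v \<in> (irrelevant_ideal :: ('n, 'k) bipoly set)" for v
      unfolding irrelevant_ideal_def using genideal_self[of "range poly_var"] by auto
    show "xform \<in> irrelevant_ideal" "yform \<in> irrelevant_ideal"
      unfolding xform_def yform_def
      by (intro ideal_diff[OF id] ideal_sum[OF id] ideal_mult_left[OF id] var)+
  qed
  show "depth (coord_ring Quot I) (coset I ` irrelevant_ideal) = 2"
  proof (intro antisym depth_quotient_le[OF id C rel])
    show "2 \<le> depth (coord_ring Quot I) (coset I ` irrelevant_ideal)"
    proof (rule two_le_depth_quotient[OF id, of xform sum_ideal yform "vanishing_on W2"])
      show "g \<in> I" if "xform * g \<in> I" for g using xform_regular that by (simp add: I)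
      show "I \<subseteq> sum_ideal" unfolding I by (rule vanishing_subset_sum_ideal)
      show "\<exists>h. g - xform * h \<in> I" if "g \<in> sum_ideal" for g
        using that by (simp add: sum_ideal_def I)
      show "I \<subseteq> vanishing_on W2" using IW0 W01 W12 by blast
      show "xform \<in> vanishing_on W2" "yform \<in> vanishing_on W2"
        by (auto simp: vanishing_on_def W2_def ev_xform ev_yform)
      show "vanishing_on W2 \<noteq> UNIV" using primeideal.I_notcarr[OF prime(3)] by auto
    qed (use irr in \<open>auto intro: ideal_sum_ideal xform_mem_sum_ideal yform_regular ideal_vanishing_on\<close>)
  qed
qed

end

section \<open>Coordinates for projective points\<close>

lemma projective_point_eq_line:
  assumes "P \<in> projective_space"
  obtains a :: "'k::field ^ 'i::finite" where "a \<noteq> 0" "P = {c *s a | c. c \<noteq> 0}"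
proof -
  from assms obtain a where a: "a \<noteq> 0" "P = proportional `` {a}"
    by (auto simp: projective_space_def quotient_def)
  then have "P = {c *s a | c. c \<noteq> 0}" by (auto simp: proportional_def vector_mul_eq_0)
  with a(1) show ?thesis by (rule that)
qed

text \<open>On the moment curve, whose points are the coefficient vectors \<open>(t\<^sup>0, t\<^sup>1, \<dots>)\<close>, each given vector excludes
  only finitely many parameters \<open>t\<close>.\<close>

lemma exists_linear_form_nonzero:
  fixes B :: "('k::field_char_0 ^ 'n::finite) set"
  assumes "finite B" "0 \<notin> B"
  shows "\<exists>w :: 'k ^ 'n. \<forall>b\<in>B. (\<Sum>i\<in>UNIV. w $ i * b $ i) \<noteq> 0"
proof -
  obtain e :: "'n \<Rightarrow> nat" where e: "inj e"
    using finite_imp_inj_to_nat_seg[OF finite[of "UNIV :: 'n set"]] by blast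
  define g where "g b = (\<Sum>i\<in>UNIV. Polynomial.monom (b $ i) (e i))" for b :: "'k ^ 'n"
  have "g b \<noteq> 0" if "b \<in> B" for b
  proof -
    have "b \<noteq> 0" using that assms(2) by blast
    then obtain i where i: "b $ i \<noteq> 0" by (auto simp: vec_eq_iff)
    have "coeff (g b) (e i) = b $ i"
      using e by (simp add: g_def coeff_sum inj_eq sum.delta)
    with i show ?thesis by auto
  qed
  then have "finite (\<Union>b\<in>B. {t. poly (g b) t = 0})" using assms(1) poly_roots_finite by blast
  then obtain t where t: "t \<notin> (\<Union>b\<in>B. {t. poly (g b) t = 0})"
    using ex_new_if_finite[OF infinite_UNIV_char_0] by blast
  show ?thesis
    by (rule exI[of _ "\<chi> i. t ^ e i"]) (use t in \<open>auto simp: g_def poly_sum poly_monom mult.commute\<close>)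
qed

lemma line_rescale:
  fixes x :: "'k::field ^ 'i"
  assumes "d \<noteq> 0"
  shows "{u *s (d *s x) | u. u \<noteq> 0} = {u *s x | u. u \<noteq> 0}"
proof (intro equalityI subsetI; clarify)
  fix u :: 'k assume "u \<noteq> 0"
  then show "\<exists>v. u *s (d *s x) = v *s x \<and> v \<noteq> 0"
    using assms by (intro exI[of _ "u * d"]) (simp add: vector_smult_assoc)
  show "\<exists>v. u *s x = v *s (d *s x) \<and> v \<noteq> 0"
    using assms \<open>u \<noteq> 0\<close> by (intro exI[of _ "u / d"]) (simp add: vector_smult_assoc)
qed

theorem theorem4p12:
  fixes n r s :: nat
    and l :: "nat \<Rightarrow> nat"
    and P :: "nat \<Rightarrow> ('k::{alg_closed_field, field_char_0} ^ 2) set"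
    and Q :: "nat \<Rightarrow> ('k ^ 'n::finite) set"
  assumes "n \<ge> 1" and "CARD('n) = n + 1"
    and "s > 0" and "is_partition l r s"
    and "\<forall>i\<in>{1..r}. P i \<in> projective_space" and "inj_on P {1..r}"
    and "\<forall>j\<in>{1..l 1}. Q j \<in> projective_space" and "inj_on Q {1..l 1}"
  shows "arithmetically_CM {(P i, Q j) | i j. 1 \<le> i \<and> i \<le> r \<and> 1 \<le> j \<and> j \<le> l i}"
proof -
  have pos: "\<forall>i\<in>{1..r}. l i > 0" and sum: "(\<Sum>i=1..r. l i) = s"
    and step: "\<forall>i\<in>{1..<r}. l i \<ge> l (i + 1)"
    using assms(4) by (auto simp: is_partition_def)
  have r: "1 \<le> r" using sum \<open>s > 0\<close> by (cases r) auto
  have anti: "l j \<le> l i" if "1 \<le> i" "i \<le> j" "j \<le> r" for i j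
    using that(2,3)
  proof (induction j rule: dec_induct)
    case (step k)
    then show ?case using \<open>1 \<le> i\<close> \<open>\<forall>i\<in>{1..<r}. l i \<ge> l (i + 1)\<close>[rule_format, of k] by simp
  qed simp
  have line: "\<exists>x. x \<noteq> 0 \<and> L = {u *s x | u. u \<noteq> 0}" if "L \<in> projective_space"
    for L :: "('k ^ 'm::finite) set"
    by (rule projective_point_eq_line[OF that]) (intro exI conjI)
  have "\<forall>i\<in>{1..r}. \<exists>x. x \<noteq> 0 \<and> P i = {u *s x | u. u \<noteq> 0}"
    by (intro ballI line assms(5)[rule_format])
  from bchoice[OF this] obtain a where
    a: "\<forall>i\<in>{1..r}. a i \<noteq> 0 \<and> P i = {u *s a i | u. u \<noteq> 0}" ..
  note a = bspec[OF a, THEN conjunct1] bspec[OF a, THEN conjunct2]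
  have "\<forall>j\<in>{1..l 1}. \<exists>x. x \<noteq> 0 \<and> Q j = {v *s x | v. v \<noteq> 0}"
    by (intro ballI line assms(7)[rule_format])
  from bchoice[OF this] obtain q where
    q: "\<forall>j\<in>{1..l 1}. q j \<noteq> 0 \<and> Q j = {v *s q j | v. v \<noteq> 0}" ..
  note q = bspec[OF q, THEN conjunct1] bspec[OF q, THEN conjunct2]
  \<comment> \<open>Any \<open>c\<close> outside this set gives a form \<open>x\<^sub>0 - c x\<^sub>1\<close> that is nonzero at every \<open>P i\<close>. Where
    \<open>a i $ 2 = 0\<close> the quotient is 0, a harmless extra exclusion, as \<open>a i $ 1\<close> is then nonzero.\<close>
  have "finite ((\<lambda>i. a i $ 1 / a i $ 2) ` {1..r})" by simp
  from ex_new_if_finite[OF infinite_UNIV_char_0 this]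
  obtain c where c: "c \<notin> (\<lambda>i. a i $ 1 / a i $ 2) ` {1..r}" by blast
  define d where "d i = a i $ 1 - c * a i $ 2" for i
  have d: "d i \<noteq> 0" if "i \<in> {1..r}" for i
  proof (cases "a i $ 2 = 0")
    case True
    then show ?thesis using a(1)[OF that] by (auto simp: d_def vec_eq_iff forall_2)
  next
    case False
    moreover have "c \<noteq> a i $ 1 / a i $ 2" using c that by blast
    ultimately show ?thesis by (simp add: d_def field_simps)
  qed
  define p where "p i = a i $ 2 / d i" for i
  have base: "a i = d i *s affine_point c (p i)" if "i \<in> {1..r}" for i
  proof -
    have dp: "d i * p i = a i $ 2" using d[OF that] by (simp add: p_def)
    have "d i * (1 + c * p i) = d i + c * (d i * p i)" by (simp add: algebra_simps)
    also have "\<dots> = a i $ 1" unfolding dp by (simp add: d_def)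
    finally show ?thesis using dp by (simp add: vec_eq_iff forall_2 affine_point_def)
  qed
  have P: "P i = {u *s affine_point c (p i) | u. u \<noteq> 0}" if "i \<in> {1..r}" for i
    unfolding a(2)[OF that] by (subst base[OF that]) (rule line_rescale[OF d[OF that]])
  have inj: "inj_on p {1..r}"
  proof (rule inj_onI)
    fix i j assume ij: "i \<in> {1..r}" "j \<in> {1..r}" "p i = p j"
    have "P i = P j" unfolding P[OF ij(1)] P[OF ij(2)] ij(3) ..
    then show "i = j" using ij(1,2) by (rule inj_onD[OF \<open>inj_on P {1..r}\<close>])
  qed
  have "\<exists>w :: 'k ^ 'n. \<forall>b\<in>q ` {1..l 1}. (\<Sum>i\<in>UNIV. w $ i * b $ i) \<noteq> 0"
    by (rule exists_linear_form_nonzero) (use q(1) in force)+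
  then obtain w :: "'k ^ 'n" where w: "\<And>j. j \<in> {1..l 1} \<Longrightarrow> (\<Sum>i\<in>UNIV. w $ i * q j $ i) \<noteq> 0"
    by blast
  interpret st: staircase r l p c q w
  proof
    show "1 \<le> l 1" using pos r by force
  qed (use r anti inj w in auto)
  let ?Z = "{(P i, Q j) | i j. 1 \<le> i \<and> i \<le> r \<and> 1 \<le> j \<and> j \<le> l i}"
  have Q: "Q j = {v *s q j | v. v \<noteq> 0}" if "1 \<le> i" "i \<le> r" "1 \<le> j" "j \<le> l i" for i j
    by (rule q(2)) (use anti[of 1 i] that in simp)
  have "vanishing_ideal ?Z = vanishing_on (bicone ?Z)"
  proof (rule vanishing_ideal_eq)
    fix P' Q' x y and t :: 'k
    assume "(P', Q') \<in> ?Z" "x \<in> P'" "y \<in> Q'" "t \<noteq> 0"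
    then obtain i j u v where *: "1 \<le> i" "i \<le> r" "1 \<le> j" "j \<le> l i" "P' = P i" "Q' = Q j"
      "x = u *s affine_point c (p i)" "y = v *s q j" "u \<noteq> 0" "v \<noteq> 0"
    proof -
      from \<open>(P', Q') \<in> ?Z\<close> obtain i j where ij: "1 \<le> i" "i \<le> r" "1 \<le> j" "j \<le> l i" "P' = P i" "Q' = Q j"
        by blast
      moreover have "i \<in> {1..r}" using ij by simp
      ultimately show ?thesis
        using \<open>x \<in> P'\<close> \<open>y \<in> Q'\<close> that P[of i] Q[of i j] by blast
    qed
    then have "t *s x = (t * u) *s affine_point c (p i)" "t *s y = (t * v) *s q j" by simp_all
    moreover have "t * u \<noteq> 0" "t * v \<noteq> 0" using * \<open>t \<noteq> 0\<close> by simp_all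
    ultimately show "t *s x \<in> P' \<and> t *s y \<in> Q'" using P[of i] Q[of i j] * by auto
  qed
  also have "bicone ?Z = st.cone"
  proof (intro equalityI subsetI)
    fix x assume "x \<in> bicone ?Z"
    then obtain i j a b where *: "1 \<le> i" "i \<le> r" "1 \<le> j" "j \<le> l i" "a \<in> P i" "b \<in> Q j" "x = point a b"
      by auto
    moreover obtain u v where "a = u *s affine_point c (p i)" "u \<noteq> 0" "b = v *s q j" "v \<noteq> 0"
      using P[of i] Q[of i j] * by auto
    ultimately show "x \<in> st.cone" unfolding st.cone_def by blast
  next
    fix x assume "x \<in> st.cone"
    then obtain u v i j where *: "1 \<le> i" "i \<le> r" "1 \<le> j" "j \<le> l i" "u \<noteq> 0" "v \<noteq> 0"
      and x: "x = point (u *s affine_point c (p i)) (v *s q j)"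
      unfolding st.cone_def by blast
    have "u *s affine_point c (p i) \<in> P i" "v *s q j \<in> Q j"
      using P[of i] Q[of i j] * by auto
    moreover have "(P i, Q j) \<in> ?Z" using * by blast
    ultimately have "\<exists>PQ\<in>?Z. u *s affine_point c (p i) \<in> fst PQ \<and> v *s q j \<in> snd PQ"
      by (intro bexI[of _ "(P i, Q j)"]) simp_all
    with x show "x \<in> bicone ?Z" by blast
  qed
  finally have "vanishing_ideal ?Z = vanishing_on st.cone" .
  from st.quotient_krull_dim_depth[OF this] show ?thesis
    by (simp add: arithmetically_CM_def Let_def)
qed

end
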